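(* Let $\mathcal{H}$ be a separable Hilbert space, let $\mathcal{F}=\{f_n\}_{n\in\mathbb{N}}$ be a frame for a closed subspace $\mathcal{W}$ of $\mathcal{H}$, with synthesis operator $T:\ell^2\to\mathcal{H}$, and let $\mathcal{M}$ be another closed subspace of $\mathcal{H}$ such that $\mathcal{H}=\mathcal{W}\dot{+}\mathcal{M}^\perp$. Let $D\in\mathcal{D}(\ell^2)$. Then the oblique dual frames $\mathcal{G}=\{g_n\}_{n\in\mathbb{N}}$ of $\mathcal{F}$ in $\mathcal{M}$ such that, for every $f\in\mathcal{W}$, the coefficient sequence $(\langle f,g_n\rangle)_{n\in\mathbb{N}}$ in the reconstruction formula minimizes the weighted norm $\|\cdot\|_D$ (that is, $\|(\langle f,g_n\rangle)_n\|_D\le\|(c_n)_n\|_D$ for every $(c_n)_n\in\ell^2$ with $f=\sum_n c_nf_n$) are exactly the sequences of the form $$\{g_n\}_{n\in\mathbb{N}}=\{B(D^{-1/2}T^*B)^\dagger D^{-1/2}e_n\}_{n\in\mathbb{N}},$$ where $\{e_n\}_{n\in\mathbb{N}}$ is the canonical orthonormal basis of $\ell^2$ and $B\in L(\ell^2,\mathcal{H})$ is any bounded operator with $R(B)=\mathcal{M}$.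
   Context: A sequence $\{f_n\}_{n\in\mathbb{N}}$ is a frame for a closed subspace $\mathcal{W}\subseteq\mathcal{H}$ if it lies in $\mathcal{W}$ and there are $A,B>0$ with $A\|f\|^2\le\sum_n|\langle f,f_n\rangle|^2\le B\|f\|^2$ for all $f\in\mathcal{W}$. Its synthesis operator is the bounded operator $T:\ell^2\to\mathcal{H}$ with $T(e_n)=f_n$. $\dot{+}$ denotes a direct (not necessarily orthogonal) sum. $L(\ell^2,\mathcal{H})$ is the space of bounded linear operators, $R(B)$ is the range of $B$, and $^\dagger$ denotes the Moore-Penrose pseudoinverse of a closed range operator. If $\mathcal{H}=\mathcal{W}\dot{+}\mathcal{M}^\perp$, an oblique dual frame of $\mathcal{F}$ in $\mathcal{M}$ is a frame $\mathcal{G}=\{g_n\}_{n\in\mathbb{N}}$ for $\mathcal{M}$ such that $f=\sum_{n=1}^\infty\langle f,g_n\rangle f_n$ for all $f\in\mathcal{W}$ (the reconstruction formula). $\mathcal{D}(\ell^2)$ is the set of all positive definite bounded invertible operators $D$ on $\ell^2$ that are diagonal in the canonical basis $\{e_n\}$. For $D\in\mathcal{D}(\ell^2)$, $\langle x,y\rangle_D=\langle Dx,y\rangle$ and $\|x\|_D=\langle x,x\rangle_D^{1/2}$ for $x,y\in\ell^2$. *)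

theory Defs
  imports "HOL-Analysis.Analysis"
begin

section \<open>Scalars: the real and the complex numbers, treated uniformly\<close>

text \<open>
  The only models are the real and the complex numbers: writing \<open>y = (x - rconj x) / 2\<close>, the
  axioms give \<open>y\<^sup>2 = - of_real ((norm y)\<^sup>2)\<close>, and the product of two such skew elements is
  again a real multiple of 1, so the real dimension is at most 2.
\<close>

class rc_scalar = real_normed_field + banach +
  fixes rconj :: "'a \<Rightarrow> 'a" and rpart :: "'a \<Rightarrow> real"
  assumes rconj_add: "rconj (x + y) = rconj x + rconj y"
    and rconj_mult: "rconj (x * y) = rconj x * rconj y"
    and rconj_rconj: "rconj (rconj x) = x"
    and mult_rconj_scaleR: "x * rconj x = (norm x)\<^sup>2 *\<^sub>R 1"
    and add_rconj_scaleR: "x + rconj x = (2 * rpart x) *\<^sub>R 1"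

lemma mult_rconj: "x * rconj x = of_real ((norm (x :: 'a::rc_scalar))\<^sup>2)"
  by (simp add: mult_rconj_scaleR of_real_def)

lemma add_rconj: "x + rconj x = of_real (2 * rpart (x :: 'a::rc_scalar))"
  by (simp add: add_rconj_scaleR of_real_def)

instantiation real :: rc_scalar
begin
definition rconj_real :: "real \<Rightarrow> real" where "rconj_real x = x"
definition rpart_real :: "real \<Rightarrow> real" where "rpart_real x = x"
instance
  by standard (auto simp: rconj_real_def rpart_real_def power2_eq_square)
end

instantiation complex :: rc_scalar
begin
definition rconj_complex :: "complex \<Rightarrow> complex" where "rconj_complex z = cnj z"
definition rpart_complex :: "complex \<Rightarrow> real" where "rpart_complex z = Re z"
instance
  by standard
    (simp_all add: rconj_complex_def rpart_complex_def complex_add_cnj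
      scaleR_conv_of_real flip: complex_norm_square)
end

section \<open>Hilbert spaces\<close>

text \<open>
  The inner product is linear in the first argument. The last two axioms say that the real vector
  space structure and the norm of the underlying type are the ones induced by \<open>scl\<close> and \<open>ip\<close>.
\<close>

locale inner_product_space = vector_space scl
  for scl :: "'k::rc_scalar \<Rightarrow> 'v::real_normed_vector \<Rightarrow> 'v" +
  fixes ip :: "'v \<Rightarrow> 'v \<Rightarrow> 'k"
  assumes ip_add_left: "ip (x + y) z = ip x z + ip y z"
    and ip_scale_left: "ip (scl a x) y = a * ip x y"
    and ip_commute: "ip y x = rconj (ip x y)"
    and scale_of_real: "scl (of_real r) x = r *\<^sub>R x"
    and ip_self: "ip x x = of_real ((norm x)\<^sup>2)"

locale hilbert_space = inner_product_space scl ip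
  for scl :: "'k::rc_scalar \<Rightarrow> 'v::real_normed_vector \<Rightarrow> 'v" and ip :: "'v \<Rightarrow> 'v \<Rightarrow> 'k" +
  assumes complete_UNIV_space: "complete (UNIV :: 'v set)"

lemma hilbert_space_real:
  "hilbert_space (scaleR :: real \<Rightarrow> 'v \<Rightarrow> 'v::{real_inner, complete_space}) (\<bullet>)"
  by unfold_locales
    (auto simp: algebra_simps inner_commute rconj_real_def power2_norm_eq_inner complete_UNIV)

lemma hilbert_space_complex: "hilbert_space (*) (\<lambda>x y :: complex. x * cnj y)"
  by unfold_locales
    (auto simp: algebra_simps rconj_complex_def scaleR_conv_of_real complete_UNIV
      simp flip: complex_norm_square)

definition orth_compl :: "('v \<Rightarrow> 'v \<Rightarrow> 'k::rc_scalar) \<Rightarrow> 'v set \<Rightarrow> 'v set" where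
  "orth_compl ip M = {x. \<forall>y\<in>M. ip x y = 0}"

definition closed_subspace ::
    "('k::rc_scalar \<Rightarrow> 'v::real_normed_vector \<Rightarrow> 'v) \<Rightarrow> 'v set \<Rightarrow> bool" where
  "closed_subspace scl W \<longleftrightarrow> module.subspace scl W \<and> closed W"

definition direct_sum_UNIV :: "'v::real_normed_vector set \<Rightarrow> 'v set \<Rightarrow> bool" where
  "direct_sum_UNIV V W \<longleftrightarrow> V \<inter> W = {0} \<and> (\<forall>x. \<exists>v\<in>V. \<exists>w\<in>W. x = v + w)"

section \<open>Bounded operators\<close>

definition bounded_op ::
    "('k::rc_scalar \<Rightarrow> 'a::real_normed_vector \<Rightarrow> 'a) \<Rightarrow> ('k \<Rightarrow> 'b::real_normed_vector \<Rightarrow> 'b) \<Rightarrow>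
      ('a \<Rightarrow> 'b) \<Rightarrow> bool" where
  "bounded_op s1 s2 A \<longleftrightarrow>
     Vector_Spaces.linear s1 s2 A \<and> (\<exists>K. \<forall>x. norm (A x) \<le> K * norm x)"

definition op_adjoint ::
    "('a \<Rightarrow> 'a \<Rightarrow> 'k::rc_scalar) \<Rightarrow> ('b \<Rightarrow> 'b \<Rightarrow> 'k) \<Rightarrow> ('a \<Rightarrow> 'b) \<Rightarrow> 'b \<Rightarrow> 'a" where
  "op_adjoint ip1 ip2 A = (THE S. \<forall>x y. ip2 (A x) y = ip1 x (S y))"

definition self_adjoint :: "('a \<Rightarrow> 'a \<Rightarrow> 'k::rc_scalar) \<Rightarrow> ('a \<Rightarrow> 'a) \<Rightarrow> bool" where
  "self_adjoint ip A \<longleftrightarrow> (\<forall>x y. ip (A x) y = ip x (A y))"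

definition positive_semidef :: "('a \<Rightarrow> 'a \<Rightarrow> 'k::rc_scalar) \<Rightarrow> ('a \<Rightarrow> 'a) \<Rightarrow> bool" where
  "positive_semidef ip A \<longleftrightarrow> self_adjoint ip A \<and> (\<forall>x. 0 \<le> rpart (ip (A x) x))"

definition positive_def :: "('a::zero \<Rightarrow> 'a \<Rightarrow> 'k::rc_scalar) \<Rightarrow> ('a \<Rightarrow> 'a) \<Rightarrow> bool" where
  "positive_def ip A \<longleftrightarrow> self_adjoint ip A \<and> (\<forall>x. x \<noteq> 0 \<longrightarrow> 0 < rpart (ip (A x) x))"

definition invertible_op ::
    "('k::rc_scalar \<Rightarrow> 'a::real_normed_vector \<Rightarrow> 'a) \<Rightarrow> ('a \<Rightarrow> 'a) \<Rightarrow> bool" where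
  "invertible_op s A \<longleftrightarrow>
     bounded_op s s A \<and> (\<exists>C. bounded_op s s C \<and> A \<circ> C = id \<and> C \<circ> A = id)"

definition op_sqrt ::
    "('k::rc_scalar \<Rightarrow> 'a::real_normed_vector \<Rightarrow> 'a) \<Rightarrow> ('a \<Rightarrow> 'a \<Rightarrow> 'k) \<Rightarrow> ('a \<Rightarrow> 'a) \<Rightarrow> 'a \<Rightarrow> 'a" where
  "op_sqrt s ip A = (THE R. bounded_op s s R \<and> positive_semidef ip R \<and> R \<circ> R = A)"

definition op_inv_sqrt ::
    "('k::rc_scalar \<Rightarrow> 'a::real_normed_vector \<Rightarrow> 'a) \<Rightarrow> ('a \<Rightarrow> 'a \<Rightarrow> 'k) \<Rightarrow> ('a \<Rightarrow> 'a) \<Rightarrow> 'a \<Rightarrow> 'a" where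
  "op_inv_sqrt s ip A = inv (op_sqrt s ip A)"

text \<open>For a bounded \<open>A\<close> between Hilbert spaces, a bounded solution of the four Penrose equations
  is unique, and it exists iff \<open>A\<close> has closed range.\<close>

definition pseudoinverse ::
    "('k::rc_scalar \<Rightarrow> 'a::real_normed_vector \<Rightarrow> 'a) \<Rightarrow> ('a \<Rightarrow> 'a \<Rightarrow> 'k) \<Rightarrow>
     ('k \<Rightarrow> 'b::real_normed_vector \<Rightarrow> 'b) \<Rightarrow> ('b \<Rightarrow> 'b \<Rightarrow> 'k) \<Rightarrow> ('a \<Rightarrow> 'b) \<Rightarrow> 'b \<Rightarrow> 'a" where
  "pseudoinverse s1 ip1 s2 ip2 A =
     (THE X. bounded_op s2 s1 X \<and> A \<circ> X \<circ> A = A \<and> X \<circ> A \<circ> X = X \<and>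
        self_adjoint ip2 (A \<circ> X) \<and> self_adjoint ip1 (X \<circ> A))"

section \<open>The space of square-summable sequences\<close>

lemma square_summable_add:
  fixes a b :: "nat \<Rightarrow> 'k::real_normed_vector"
  assumes "summable (\<lambda>n. (norm (a n))\<^sup>2)" "summable (\<lambda>n. (norm (b n))\<^sup>2)"
  shows "summable (\<lambda>n. (norm (a n + b n))\<^sup>2)"
proof (rule summable_comparison_test')
  show "summable (\<lambda>n. 2 * (norm (a n))\<^sup>2 + 2 * (norm (b n))\<^sup>2)"
    using assms by (intro summable_add summable_mult)
  fix n :: nat
  have "(norm (a n + b n))\<^sup>2 \<le> (norm (a n) + norm (b n))\<^sup>2"
    by (simp add: norm_triangle_ineq power_mono)
  also have "\<dots> \<le> 2 * (norm (a n))\<^sup>2 + 2 * (norm (b n))\<^sup>2"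
    using zero_le_power2[of "norm (a n) - norm (b n)"]
    by (simp add: power2_eq_square algebra_simps)
  finally show "norm ((norm (a n + b n))\<^sup>2) \<le> 2 * (norm (a n))\<^sup>2 + 2 * (norm (b n))\<^sup>2"
    by simp
qed

typedef (overloaded) 'k ell2 =
  "{a :: nat \<Rightarrow> 'k::rc_scalar. summable (\<lambda>n. (norm (a n))\<^sup>2)}"
  morphisms coord Abs_ell2
  by (rule exI[of _ "\<lambda>_. 0"]) simp

setup_lifting type_definition_ell2

instantiation ell2 :: (rc_scalar) real_normed_vector
begin

lift_definition zero_ell2 :: "'a ell2" is "\<lambda>_. 0" by simp

lift_definition uminus_ell2 :: "'a ell2 \<Rightarrow> 'a ell2" is "\<lambda>a n. - a n" by simp

lift_definition plus_ell2 :: "'a ell2 \<Rightarrow> 'a ell2 \<Rightarrow> 'a ell2" is "\<lambda>a b n. a n + b n"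
  by (rule square_summable_add)

lift_definition minus_ell2 :: "'a ell2 \<Rightarrow> 'a ell2 \<Rightarrow> 'a ell2" is "\<lambda>a b n. a n - b n"
  subgoal for a b
    using square_summable_add[of a "\<lambda>n. - b n"] by simp
  done

lift_definition scaleR_ell2 :: "real \<Rightarrow> 'a ell2 \<Rightarrow> 'a ell2" is "\<lambda>r a n. r *\<^sub>R a n"
  by (simp add: power_mult_distrib summable_mult)

lift_definition norm_ell2 :: "'a ell2 \<Rightarrow> real" is "\<lambda>a. sqrt (\<Sum>n. (norm (a n))\<^sup>2)" .

definition sgn_ell2 :: "'a ell2 \<Rightarrow> 'a ell2" where "sgn_ell2 x = inverse (norm x) *\<^sub>R x"
definition dist_ell2 :: "'a ell2 \<Rightarrow> 'a ell2 \<Rightarrow> real" where "dist_ell2 x y = norm (x - y)"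
definition uniformity_ell2 :: "('a ell2 \<times> 'a ell2) filter" where
  "uniformity_ell2 = (INF e\<in>{0<..}. principal {(x, y). dist x y < e})"
definition open_ell2 :: "'a ell2 set \<Rightarrow> bool" where
  "open_ell2 U \<longleftrightarrow> (\<forall>x\<in>U. \<forall>\<^sub>F (x', y) in uniformity. x' = x \<longrightarrow> y \<in> U)"

instance
proof
  fix x y z :: "'a ell2" and r s :: real
  show "x + y + z = x + (y + z)" by transfer (simp add: add.assoc)
  show "x + y = y + x" by transfer (simp add: add.commute)
  show "0 + x = x" by transfer simp
  show "- x + x = 0" by transfer simp
  show "x - y = x + - y" by transfer simp
  show "r *\<^sub>R (x + y) = r *\<^sub>R x + r *\<^sub>R y" by transfer (simp add: scaleR_right_distrib)
  show "(r + s) *\<^sub>R x = r *\<^sub>R x + s *\<^sub>R x" by transfer (simp add: scaleR_left_distrib)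
  show "r *\<^sub>R s *\<^sub>R x = (r * s) *\<^sub>R x" by transfer simp
  show "1 *\<^sub>R x = x" by transfer simp
  show "norm x = 0 \<longleftrightarrow> x = 0"
  proof transfer
    fix a :: "nat \<Rightarrow> 'a" assume "summable (\<lambda>n. (norm (a n))\<^sup>2)"
    then show "sqrt (\<Sum>n. (norm (a n))\<^sup>2) = 0 \<longleftrightarrow> a = (\<lambda>_. 0)"
      by (auto simp: suminf_eq_zero_iff fun_eq_iff)
  qed
  show "norm (x + y) \<le> norm x + norm y"
  proof transfer
    fix a b :: "nat \<Rightarrow> 'a"
    assume a: "summable (\<lambda>n. (norm (a n))\<^sup>2)" and b: "summable (\<lambda>n. (norm (b n))\<^sup>2)"
    have ab: "summable (\<lambda>n. (norm (a n + b n))\<^sup>2)" by (rule square_summable_add[OF a b])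
    have L: "(\<lambda>n. L2_set (\<lambda>i. norm (c i)) {..<n}) \<longlonglongrightarrow> sqrt (\<Sum>n. (norm (c n))\<^sup>2)"
      if "summable (\<lambda>n. (norm (c n))\<^sup>2)" for c :: "nat \<Rightarrow> 'a"
      unfolding L2_set_def by (intro tendsto_real_sqrt summable_LIMSEQ that)
    show "sqrt (\<Sum>n. (norm (a n + b n))\<^sup>2)
        \<le> sqrt (\<Sum>n. (norm (a n))\<^sup>2) + sqrt (\<Sum>n. (norm (b n))\<^sup>2)"
    proof (rule LIMSEQ_le[OF L[OF ab] tendsto_add[OF L[OF a] L[OF b]]], intro exI allI impI)
      fix n :: nat
      have "L2_set (\<lambda>i. norm (a i + b i)) {..<n} \<le> L2_set (\<lambda>i. norm (a i) + norm (b i)) {..<n}"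
        by (intro L2_set_mono) (auto simp: norm_triangle_ineq)
      also have "\<dots> \<le> L2_set (\<lambda>i. norm (a i)) {..<n} + L2_set (\<lambda>i. norm (b i)) {..<n}"
        by (rule L2_set_triangle_ineq)
      finally show "L2_set (\<lambda>i. norm (a i + b i)) {..<n}
          \<le> L2_set (\<lambda>i. norm (a i)) {..<n} + L2_set (\<lambda>i. norm (b i)) {..<n}" .
    qed
  qed
  show "norm (r *\<^sub>R x) = \<bar>r\<bar> * norm x"
    by transfer (simp add: power_mult_distrib suminf_mult real_sqrt_mult)
qed (simp_all add: sgn_ell2_def dist_ell2_def uniformity_ell2_def open_ell2_def)

end

lift_definition ell2_scale :: "'k::rc_scalar \<Rightarrow> 'k ell2 \<Rightarrow> 'k ell2" is "\<lambda>c a n. c * a n"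
  by (simp add: norm_mult power_mult_distrib summable_mult)

lift_definition ell2_ip :: "'k::rc_scalar ell2 \<Rightarrow> 'k ell2 \<Rightarrow> 'k" is
  "\<lambda>a b. \<Sum>n. a n * rconj (b n)" .

lift_definition ell2_basis :: "nat \<Rightarrow> 'k::rc_scalar ell2" is "\<lambda>n m. if m = n then 1 else 0"
  subgoal for n by (rule summable_finite[of "{n}"]) auto
  done

lemma norm_rconj: "norm (rconj x) = norm (x :: 'k::rc_scalar)"
proof -
  have "(of_real ((norm (rconj x))\<^sup>2) :: 'k) = of_real ((norm x)\<^sup>2)"
    by (metis mult.commute mult_rconj rconj_rconj)
  then have "(norm (rconj x))\<^sup>2 = (norm x)\<^sup>2"
    using of_real_eq_iff by blast
  then show ?thesis by simp
qed

lemma bounded_linear_rconj: "bounded_linear (rconj :: 'k::rc_scalar \<Rightarrow> 'k)"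
proof (rule bounded_linear_intro[where K = 1])
  fix r and x :: 'k
  have "rconj (of_real r :: 'k) = of_real r"
  proof (cases "r = 0")
    case True
    then show ?thesis using rconj_add[of "0::'k" 0] by simp
  next
    case False
    have "(of_real r :: 'k) * rconj (of_real r) = of_real r * of_real r"
      by (simp add: mult_rconj power2_eq_square flip: of_real_mult)
    with False show ?thesis by simp
  qed
  then show "rconj (r *\<^sub>R x) = r *\<^sub>R rconj x"
    by (simp add: scaleR_conv_of_real rconj_mult)
qed (simp_all add: rconj_add norm_rconj)

lemma summable_ell2_ip:
  fixes a b :: "nat \<Rightarrow> 'k::rc_scalar"
  assumes "summable (\<lambda>n. (norm (a n))\<^sup>2)" "summable (\<lambda>n. (norm (b n))\<^sup>2)"
  shows "summable (\<lambda>n. a n * rconj (b n))"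
proof (rule summable_comparison_test')
  show "summable (\<lambda>n. (norm (a n))\<^sup>2 + (norm (b n))\<^sup>2)"
    using assms by (rule summable_add)
  fix n :: nat
  have "0 \<le> norm (a n) * norm (b n)" by simp
  with sum_squares_bound[of "norm (a n)" "norm (b n)"]
  show "norm (a n * rconj (b n)) \<le> (norm (a n))\<^sup>2 + (norm (b n))\<^sup>2"
    unfolding norm_mult norm_rconj by linarith
qed

interpretation ell2: inner_product_space "ell2_scale :: 'k::rc_scalar \<Rightarrow> _" ell2_ip
proof
  fix x y z :: "'k ell2" and a b :: 'k and r :: real
  show "ell2_scale a (x + y) = ell2_scale a x + ell2_scale a y"
    by transfer (simp add: algebra_simps)
  show "ell2_scale (a + b) x = ell2_scale a x + ell2_scale b x"
    by transfer (simp add: algebra_simps)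
  show "ell2_scale a (ell2_scale b x) = ell2_scale (a * b) x"
    by transfer (simp add: algebra_simps)
  show "ell2_scale 1 x = x" by transfer simp
  show "ell2_ip (x + y) z = ell2_ip x z + ell2_ip y z"
    by transfer (simp add: distrib_right suminf_add summable_ell2_ip)
  show "ell2_ip (ell2_scale a x) y = a * ell2_ip x y"
    by transfer (simp add: mult.assoc suminf_mult summable_ell2_ip)
  show "ell2_ip y x = rconj (ell2_ip x y)"
    by transfer
      (simp add: bounded_linear.suminf[OF bounded_linear_rconj] summable_ell2_ip rconj_mult
        rconj_rconj mult.commute)
  show "ell2_scale (of_real r) x = r *\<^sub>R x"
    by transfer (simp add: scaleR_conv_of_real)
  show "ell2_ip x x = of_real ((norm x)\<^sup>2)"
    by transfer
      (simp add: mult_rconj suminf_nonneg bounded_linear.suminf[OF bounded_linear_of_real]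
        del: of_real_power)
qed

definition diag_ops :: "('k::rc_scalar ell2 \<Rightarrow> 'k ell2) set" where
  "diag_ops = {D. invertible_op ell2_scale D \<and> positive_def ell2_ip D \<and>
     (\<forall>n. \<exists>d. D (ell2_basis n) = ell2_scale d (ell2_basis n))}"

definition weighted_ip :: "('k::rc_scalar ell2 \<Rightarrow> 'k ell2) \<Rightarrow> 'k ell2 \<Rightarrow> 'k ell2 \<Rightarrow> 'k" where
  "weighted_ip D x y = ell2_ip (D x) y"

definition weighted_norm :: "('k::rc_scalar ell2 \<Rightarrow> 'k ell2) \<Rightarrow> 'k ell2 \<Rightarrow> real" where
  "weighted_norm D x = sqrt (rpart (weighted_ip D x x))"

section \<open>Frames and oblique dual frames\<close>

definition frame_for ::
    "('v \<Rightarrow> 'v \<Rightarrow> 'k::rc_scalar) \<Rightarrow> (nat \<Rightarrow> 'v::real_normed_vector) \<Rightarrow> 'v set \<Rightarrow> bool" where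
  "frame_for ip f W \<longleftrightarrow> range f \<subseteq> W \<and>
     (\<exists>A>0. \<exists>B>0. \<forall>h\<in>W. summable (\<lambda>n. (norm (ip h (f n)))\<^sup>2) \<and>
        A * (norm h)\<^sup>2 \<le> (\<Sum>n. (norm (ip h (f n)))\<^sup>2) \<and>
        (\<Sum>n. (norm (ip h (f n)))\<^sup>2) \<le> B * (norm h)\<^sup>2)"

definition synthesis ::
    "('k::rc_scalar \<Rightarrow> 'v::real_normed_vector \<Rightarrow> 'v) \<Rightarrow> (nat \<Rightarrow> 'v) \<Rightarrow> 'k ell2 \<Rightarrow> 'v" where
  "synthesis scl f =
     (THE T. bounded_op ell2_scale scl T \<and> (\<forall>n. T (ell2_basis n) = f n))"

definition oblique_dual_frame ::
    "('k::rc_scalar \<Rightarrow> 'v::real_normed_vector \<Rightarrow> 'v) \<Rightarrow> ('v \<Rightarrow> 'v \<Rightarrow> 'k) \<Rightarrow>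
      (nat \<Rightarrow> 'v) \<Rightarrow> 'v set \<Rightarrow> 'v set \<Rightarrow> (nat \<Rightarrow> 'v) \<Rightarrow> bool" where
  "oblique_dual_frame scl ip f W M g \<longleftrightarrow>
     frame_for ip g M \<and> (\<forall>h\<in>W. (\<lambda>n. scl (ip h (g n)) (f n)) sums h)"

text \<open>
  The coefficients \<open>\<langle>h, g n\<rangle>\<close> are required to form an element of \<open>\<ell>\<^sup>2\<close>, and this element to
  have least weighted norm among all the coefficient sequences of \<open>h\<close> in \<open>\<ell>\<^sup>2\<close>.
\<close>

definition minimal_coefficients ::
    "('k::rc_scalar \<Rightarrow> 'v::real_normed_vector \<Rightarrow> 'v) \<Rightarrow> ('v \<Rightarrow> 'v \<Rightarrow> 'k) \<Rightarrow>
      ('k ell2 \<Rightarrow> 'k ell2) \<Rightarrow> (nat \<Rightarrow> 'v) \<Rightarrow> 'v set \<Rightarrow> (nat \<Rightarrow> 'v) \<Rightarrow> bool" where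
  "minimal_coefficients scl ip D f W g \<longleftrightarrow>
     (\<forall>h\<in>W. \<exists>a. (\<forall>n. coord a n = ip h (g n)) \<and>
        (\<forall>c. (\<lambda>n. scl (coord c n) (f n)) sums h \<longrightarrow> weighted_norm D a \<le> weighted_norm D c))"

end

theory Submission
  imports Defs
begin

text \<open>
  Write \<open>T'\<close> for the adjoint of the synthesis operator \<open>T\<close>, \<open>S = D\<^sup>1\<^sup>/\<^sup>2\<close> and \<open>E = D\<^sup>-\<^sup>1\<^sup>/\<^sup>2\<close>. For \<open>B\<close> with
  range \<open>M\<close> put \<open>A = E T' B\<close>, \<open>X = A\<^sup>\<dagger>\<close> and \<open>V = B X E\<close>, so that the sequence in question is
  \<open>g\<^sub>n = V e\<^sub>n\<close> and the coefficient sequence of \<open>h\<close> is \<open>V' h\<close>, with \<open>V'\<close> the adjoint of \<open>V\<close>. Two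
  identities carry the proof (\<open>dual_op_properties\<close>): \<open>V T' = id\<close> on \<open>M\<close>, and \<open>V D = 0\<close> on
  \<open>ker T\<close>. By the first, \<open>T V' h - h\<close> is orthogonal to \<open>M\<close>; for \<open>h \<in> W\<close> it also lies in \<open>W\<close>,
  and \<open>W \<inter> M\<^sup>\<bottom> = {0}\<close>, so \<open>T V' h = h\<close>, which is the reconstruction formula. By the second,
  \<open>D V' h\<close> is orthogonal to \<open>ker T\<close>, which is the normal equation for the least weighted norm.

  Conversely, a minimal coefficient sequence is unique, and \<open>g\<^sub>n \<in> M\<close> is determined by the numbers
  \<open>\<langle>h, g\<^sub>n\<rangle>\<close> for \<open>h \<in> W\<close> because \<open>M \<inter> W\<^sup>\<bottom> = {0}\<close>. Hence there is at most one minimal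
  dual, all choices of \<open>B\<close> give the same sequence, and it suffices to exhibit a single \<open>B\<close>, namely
  \<open>T\<close> followed by the orthogonal projection onto \<open>M\<close>.

  What remains is that the operators exist. The pseudoinverse \<open>X\<close> exists when \<open>A\<close> has closed
  range, and \<open>R(A) = E T' M\<close> is closed since \<open>T'\<close> is bounded below on \<open>M\<close>. This estimate, as well
  as the boundedness of pseudoinverses and the closed range theorem, comes from a single application
  of uniform boundedness, \<open>adjoint_bounded_below\<close>, which takes the place of the open mapping theorem.
  The root \<open>S\<close> is the diagonal operator of the square roots; as \<open>op_sqrt\<close> is specified by
  uniqueness, positive square roots have to be shown unique (\<open>op_sqrt_diag_op\<close>).
\<close>

section \<open>Elementary geometry of inner product spaces\<close>

lemma rconj_of_real [simp]: "rconj (of_real r :: 'k::rc_scalar) = of_real r"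
proof -
  have "rconj (1::'k) = 1"
    using rconj_mult[of "rconj 1" "1::'k"] by (simp add: rconj_rconj)
  then show ?thesis
    using linear_simps(5)[OF bounded_linear_rconj, of r "1::'k"] by (simp add: of_real_def)
qed

lemma rpart_of_real [simp]: "rpart (of_real r :: 'k::rc_scalar) = r"
proof -
  have "(of_real (2 * r) :: 'k) = of_real (2 * rpart (of_real r :: 'k))"
    using add_rconj[of "of_real r :: 'k"] by simp
  then show ?thesis unfolding of_real_eq_iff by simp
qed

lemma rpart_add: "rpart (x + y :: 'k::rc_scalar) = rpart x + rpart y"
proof -
  have "(of_real (2 * rpart (x + y)) :: 'k) = of_real (2 * rpart x) + of_real (2 * rpart y)"
    unfolding add_rconj[symmetric] rconj_add by (simp add: algebra_simps)
  then have "(of_real (2 * rpart (x + y)) :: 'k) = of_real (2 * rpart x + 2 * rpart y)"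
    by simp
  then show ?thesis unfolding of_real_eq_iff by simp
qed

lemma rpart_rconj: "rpart (rconj x) = rpart (x :: 'k::rc_scalar)"
proof -
  have "(of_real (2 * rpart (rconj x)) :: 'k) = of_real (2 * rpart x)"
    unfolding add_rconj[symmetric] rconj_rconj by (simp add: algebra_simps)
  then show ?thesis unfolding of_real_eq_iff by simp
qed

lemma rconj_zero [simp]: "rconj (0 :: 'k::rc_scalar) = 0"
  using rconj_of_real[of 0] by simp

lemma rpart_zero [simp]: "rpart (0 :: 'k::rc_scalar) = 0"
  using rpart_of_real[of 0] by simp

lemma rconj_eq_zero_iff [simp]: "rconj x = 0 \<longleftrightarrow> (x :: 'k::rc_scalar) = 0"
  by (metis norm_eq_zero norm_rconj)

lemma rconj_fixed_is_real:
  assumes "rconj x = (x :: 'k::rc_scalar)"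
  shows "x = of_real (rpart x)"
proof -
  have "of_real 2 * x = of_real 2 * of_real (rpart x)"
    using add_rconj[of x] assms by simp
  then show ?thesis by simp
qed

context inner_product_space
begin

lemma ip_add_right: "ip x (y + z) = ip x y + ip x z"
proof -
  have "ip x (y + z) = rconj (ip (y + z) x)" by (rule ip_commute)
  also have "\<dots> = rconj (ip y x) + rconj (ip z x)" by (simp add: ip_add_left rconj_add)
  finally show ?thesis by (simp flip: ip_commute)
qed

lemma ip_scale_right: "ip x (scl a y) = rconj a * ip x y"
proof -
  have "ip x (scl a y) = rconj (ip (scl a y) x)" by (rule ip_commute)
  also have "\<dots> = rconj a * rconj (ip y x)" by (simp add: ip_scale_left rconj_mult)
  finally show ?thesis by (simp flip: ip_commute)
qed

lemma ip_zero_left [simp]: "ip 0 y = 0"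
  using ip_add_left[of 0 0 y] by simp

lemma ip_zero_right [simp]: "ip x 0 = 0"
  using ip_add_right[of x 0 0] by simp

lemma ip_minus_left: "ip (- x) y = - ip x y"
  using ip_add_left[of x "- x" y] by (simp add: eq_neg_iff_add_eq_0 add.commute)

lemma ip_minus_right: "ip x (- y) = - ip x y"
  using ip_add_right[of x y "- y"] by (simp add: eq_neg_iff_add_eq_0 add.commute)

lemma ip_diff_left: "ip (x - y) z = ip x z - ip y z"
  using ip_add_left[of x "- y" z] by (simp add: ip_minus_left)

lemma ip_diff_right: "ip x (y - z) = ip x y - ip x z"
  using ip_add_right[of x y "- z"] by (simp add: ip_minus_right)

lemma ip_scaleR_left: "ip (r *\<^sub>R x) y = of_real r * ip x y"
  by (metis scale_of_real ip_scale_left)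

lemma ip_eq_zero_commute: "ip x y = 0 \<longleftrightarrow> ip y x = 0"
  using ip_commute[of x y] by simp

lemma norm_sq_add: "(norm (x + y))\<^sup>2 = (norm x)\<^sup>2 + 2 * rpart (ip x y) + (norm y)\<^sup>2"
proof -
  have ns: "(norm z)\<^sup>2 = rpart (ip z z)" for z
    unfolding ip_self rpart_of_real by simp
  have "rpart (ip y x) = rpart (ip x y)"
    using ip_commute[of x y] by (simp add: rpart_rconj)
  then show ?thesis
    unfolding ns by (simp add: ip_add_left ip_add_right rpart_add)
qed

lemma pythagoras: "ip x y = 0 \<Longrightarrow> (norm (x + y))\<^sup>2 = (norm x)\<^sup>2 + (norm y)\<^sup>2"
  by (simp add: norm_sq_add)

lemma ip_all_zero: "(\<And>y. ip x y = 0) \<Longrightarrow> x = 0"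
  using ip_self[of x] by simp

lemma ip_ext: "(\<And>y. ip x y = ip x' y) \<Longrightarrow> x = x'"
  using ip_all_zero[of "x - x'"] by (simp add: ip_diff_left)

lemma ip_ext_right: "(\<And>y. ip y x = ip y x') \<Longrightarrow> x = x'"
  by (rule ip_ext) (metis ip_commute)

text \<open>Expanding \<open>0 \<le> \<parallel>\<parallel>y\<parallel>\<^sup>2 x - \<langle>x, y\<rangle> y\<parallel>\<^sup>2\<close>: the vector is
  orthogonal to \<open>y\<close>, so Pythagoras applies to \<open>\<parallel>y\<parallel>\<^sup>2 x\<close>.\<close>

lemma Cauchy_Schwarz: "norm (ip x y) \<le> norm x * norm y"
proof (cases "y = 0")
  case False
  define p where "p = scl (ip x y) y"
  define q where "q = (norm y)\<^sup>2 *\<^sub>R x - p"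
  have "ip q y = 0"
    by (simp add: q_def p_def ip_diff_left ip_scaleR_left ip_scale_left ip_self)
  then have "ip q p = 0" by (simp add: p_def ip_scale_right)
  from pythagoras[OF this] have "(norm ((norm y)\<^sup>2 *\<^sub>R x))\<^sup>2 = (norm q)\<^sup>2 + (norm p)\<^sup>2"
    by (simp add: q_def)
  then have le: "(norm p)\<^sup>2 \<le> ((norm y)\<^sup>2 * norm x)\<^sup>2" by simp
  have "(of_real ((norm p)\<^sup>2) :: 'k) = of_real ((norm (ip x y) * norm y)\<^sup>2)"
    unfolding ip_self[symmetric] p_def ip_scale_left ip_scale_right
    by (simp add: ip_self mult.assoc[symmetric] mult_rconj mult.commute[of "rconj _"] power_mult_distrib)
  then have "(norm p)\<^sup>2 = (norm (ip x y) * norm y)\<^sup>2" unfolding of_real_eq_iff .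
  with le have "norm (ip x y) * norm y \<le> (norm y)\<^sup>2 * norm x"
    by (simp add: power2_le_iff_abs_le abs_mult)
  with False show ?thesis by (simp add: power2_eq_square mult.commute)
qed simp

lemma bounded_linear_ip_left: "bounded_linear (\<lambda>x. ip x y)"
  by (rule bounded_linear_intro[where K = "norm y"])
    (auto simp: ip_add_left ip_scaleR_left scaleR_conv_of_real Cauchy_Schwarz)

lemma subspace_orth_compl: "subspace (orth_compl ip N)"
  by (auto simp: subspace_def orth_compl_def ip_add_left ip_scale_left)

lemma subspace_scaleR: "subspace K \<Longrightarrow> x \<in> K \<Longrightarrow> r *\<^sub>R x \<in> K"
  by (metis scale_of_real subspace_scale)

end

section \<open>Projection theorem, Riesz representation and uniform boundedness\<close>

context hilbert_space
begin

lemma real_part_ip_zero_imp: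
  assumes "\<And>c. rpart (ip x (scl c y)) = 0"
  shows "ip x y = 0"
proof -
  have "rpart (ip x (scl (ip x y) y)) = (norm (ip x y))\<^sup>2"
    by (simp add: ip_scale_right mult.commute mult_rconj del: of_real_power)
  with assms show ?thesis by simp
qed

text \<open>A minimizing sequence for the distance from \<open>x\<close> to \<open>K\<close> is Cauchy by the parallelogram law.
  At its limit \<open>p\<close> the derivative of \<open>\<parallel>x - p + t q\<parallel>\<^sup>2\<close> at \<open>t = 0\<close> vanishes, so the real part of
  \<open>\<langle>x - p, q\<rangle>\<close> is zero, and applying this to the scalar multiples of \<open>q\<close> removes the
  restriction to real parts.\<close>

lemma projection_exists:
  assumes K: "closed_subspace scl K"
  shows "\<exists>p\<in>K. x - p \<in> orth_compl ip K"
proof -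
  have sub: "subspace K" and cl: "closed K" using K by (auto simp: closed_subspace_def)
  have ne: "K \<noteq> {}" using subspace_0[OF sub] by auto
  define d where "d = infdist x K"
  have dle: "d \<le> norm (x - k)" if "k \<in> K" for k
    using infdist_le[OF that, of x] by (simp add: d_def dist_norm)
  have d0: "0 \<le> d" by (simp add: d_def infdist_nonneg)
  have "\<exists>k\<in>K. norm (x - k) < d + 1 / Suc n" for n
  proof (rule ccontr)
    assume "\<not> ?thesis"
    then have "d + 1 / Suc n \<le> infdist x K"
      unfolding infdist_notempty[OF ne] by (intro cINF_greatest ne) (force simp: dist_norm)
    then show False by (simp add: d_def)
  qed
  then obtain k where kK: "\<And>n. k n \<in> K" and kd: "\<And>n. norm (x - k n) < d + 1 / Suc n"
    by metis
  have par: "(norm (u + v))\<^sup>2 + (norm (u - v))\<^sup>2 = 2 * (norm u)\<^sup>2 + 2 * (norm v)\<^sup>2" for u v :: 'v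
  proof -
    have "rpart (ip u v) + rpart (ip u (- v)) = 0" by (simp flip: rpart_add ip_add_right)
    then show ?thesis using norm_sq_add[of u v] norm_sq_add[of u "- v"] by simp
  qed
  have close: "(norm (k m - k n))\<^sup>2 \<le> (8 * d + 4) * (1 / Suc N)"
    if "m \<ge> N" "n \<ge> N" for m n N
  proof -
    \<comment> \<open>The midpoint of \<open>k m\<close> and \<open>k n\<close> has distance at least \<open>d\<close> from \<open>x\<close>, so the parallelogram
        law bounds the left side by \<open>4 (d + e)\<^sup>2 - 4 d\<^sup>2\<close>, and \<open>e \<le> 1\<close>.\<close>
    define e where "e = 1 / real (Suc N)"
    have e: "0 < e" "e \<le> 1" by (auto simp: e_def)
    have le: "norm (x - k i) \<le> d + e" if "i \<ge> N" for i
      using kd[of i] that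
      by (smt (verit, best) e_def frac_le of_nat_0_less_iff of_nat_le_iff Suc_le_mono zero_less_Suc)
    have "(1/2) *\<^sub>R (k m + k n) \<in> K" by (intro subspace_scaleR subspace_add sub kK)
    from dle[OF this] have "2 * d \<le> norm (2 *\<^sub>R (x - (1/2) *\<^sub>R (k m + k n)))" by simp
    also have "2 *\<^sub>R (x - (1/2) *\<^sub>R (k m + k n)) = (x - k m) + (x - k n)"
      by (simp add: algebra_simps scaleR_2)
    finally have "(2 * d)\<^sup>2 \<le> (norm ((x - k m) + (x - k n)))\<^sup>2" using d0 by (intro power_mono) auto
    moreover have "(norm (x - k m))\<^sup>2 \<le> (d + e)\<^sup>2" "(norm (x - k n))\<^sup>2 \<le> (d + e)\<^sup>2"
      using le that by (auto intro!: power_mono)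
    moreover have "norm ((x - k m) - (x - k n)) = norm (k m - k n)"
      by (metis diff_diff_eq2 add.commute diff_add_cancel minus_diff_eq norm_minus_commute
          add_diff_cancel_left diff_diff_add)
    ultimately have "(norm (k m - k n))\<^sup>2 \<le> 4 * (d + e)\<^sup>2 - (2 * d)\<^sup>2"
      using par[of "x - k m" "x - k n"] by simp
    also have "\<dots> = 8 * d * e + 4 * (e * e)" by (simp add: power2_eq_square algebra_simps)
    also have "\<dots> \<le> 8 * d * e + 4 * e" using e by (simp add: mult_left_le)
    finally show ?thesis by (simp add: e_def algebra_simps add_divide_distrib)
  qed
  have "Cauchy k"
  proof (rule metric_CauchyI)
    fix r :: real assume r: "0 < r"
    have "(\<lambda>N. (8 * d + 4) * (1 / real (Suc N))) \<longlonglongrightarrow> (8 * d + 4) * 0"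
      by (intro tendsto_mult tendsto_const LIMSEQ_Suc[OF lim_1_over_n])
    then have "\<forall>\<^sub>F N in sequentially. (8 * d + 4) * (1 / real (Suc N)) < r\<^sup>2"
      using r by (intro order_tendstoD(2)) auto
    then obtain N where N: "(8 * d + 4) * (1 / real (Suc N)) < r\<^sup>2"
      by (auto simp: eventually_sequentially)
    have "dist (k m) (k n) < r" if "m \<ge> N" "n \<ge> N" for m n
      using close[OF that] N r by (simp add: dist_norm) (metis power2_less_imp_less less_imp_le
          order_le_less_trans times_divide_eq_right mult.right_neutral)
    then show "\<exists>N. \<forall>m\<ge>N. \<forall>n\<ge>N. dist (k m) (k n) < r" by blast
  qed
  then obtain p where p: "k \<longlonglongrightarrow> p"
    using complete_UNIV_space by (auto simp: complete_def)
  have pK: "p \<in> K" using closed_sequentially[OF cl] kK p by blast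
  have "norm (x - p) \<le> d"
  proof (rule LIMSEQ_le[OF tendsto_norm[OF tendsto_diff[OF tendsto_const p]]])
    show "(\<lambda>n. d + 1 / real (Suc n)) \<longlonglongrightarrow> d"
      using tendsto_add[OF tendsto_const[of d] LIMSEQ_Suc[OF lim_1_over_n]] by simp
    show "\<exists>N. \<forall>n\<ge>N. norm (x - k n) \<le> d + 1 / real (Suc n)"
      using kd by (blast intro: less_imp_le)
  qed
  with dle have min: "norm (x - p) \<le> norm (x - q)" if "q \<in> K" for q using that by fastforce
  have re0: "rpart (ip (x - p) q) = 0" if q: "q \<in> K" for q
  proof (rule ccontr)
    define b where "b = rpart (ip (x - p) q)"
    assume "rpart (ip (x - p) q) \<noteq> 0"
    then have b: "b \<noteq> 0" by (simp add: b_def)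
    define N where "N = (norm q)\<^sup>2"
    have N: "N > 0" using b by (auto simp: N_def b_def)
    \<comment> \<open>the minimizer of \<open>2 t b + t\<^sup>2 N\<close>, the change in squared distance along \<open>q\<close>\<close>
    define t where "t = - (b / N)"
    have mv: "rpart (ip (x - p) (t *\<^sub>R q)) = t * b"
    proof -
      have "rpart (ip (t *\<^sub>R q) (x - p)) = t * rpart (ip q (x - p))" for t
      proof -
        have "(of_real (2 * rpart (of_real t * z)) :: 'k) = of_real (2 * (t * rpart z))" for z :: 'k
          unfolding add_rconj[symmetric] rconj_mult rconj_of_real
          by (metis add_rconj distrib_left mult.left_commute of_real_mult)
        then have "rpart (of_real t * z) = t * rpart z" for z :: 'k
          unfolding of_real_eq_iff by simp
        then show ?thesis by (simp add: ip_scaleR_left)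
      qed
      then show ?thesis unfolding b_def by (metis ip_commute rpart_rconj)
    qed
    have "p - t *\<^sub>R q \<in> K" by (intro subspace_diff sub pK subspace_scaleR q)
    from min[OF this] have "(norm (x - p))\<^sup>2 \<le> (norm ((x - p) + t *\<^sub>R q))\<^sup>2"
      by (intro power_mono) (auto simp: algebra_simps)
    also have "\<dots> = (norm (x - p))\<^sup>2 + 2 * (t * b) + t\<^sup>2 * N"
      by (simp add: norm_sq_add mv N_def power_mult_distrib)
    finally have "0 \<le> 2 * (t * b) + t\<^sup>2 * N" by simp
    also have "2 * (t * b) + t\<^sup>2 * N = - (b\<^sup>2 / N)"
      using N by (simp add: t_def power2_eq_square field_simps)
    finally show False using b N by (simp add: divide_le_0_iff)
  qed
  have "ip (x - p) q = 0" if "q \<in> K" for q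
    by (rule real_part_ip_zero_imp) (intro re0 subspace_scale sub that)
  with pK show ?thesis by (auto simp: orth_compl_def)
qed

lemma orth_compl_orth_compl:
  assumes K: "closed_subspace scl K" and x: "\<And>y. y \<in> orth_compl ip K \<Longrightarrow> ip x y = 0"
  shows "x \<in> K"
proof -
  obtain p where p: "p \<in> K" "x - p \<in> orth_compl ip K" using projection_exists[OF K] by blast
  have "ip (x - p) p = 0" using p by (auto simp: orth_compl_def)
  moreover have "ip x (x - p) = 0" using x p by blast
  ultimately have "ip (x - p) (x - p) = 0"
    by (metis ip_diff_left ip_eq_zero_commute diff_zero)
  then show ?thesis using p by (simp add: ip_self)
qed

text \<open>A vector \<open>u\<close> orthogonal to the kernel of \<open>\<phi>\<close> represents \<open>\<phi>\<close> up to a scalar, since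
  \<open>\<phi>(u) x - \<phi>(x) u\<close> lies in that kernel.\<close>

lemma Riesz_representation:
  assumes add: "\<And>x y. \<phi> (x + y) = \<phi> x + \<phi> y" and scale: "\<And>a x. \<phi> (scl a x) = a * \<phi> x"
    and bound: "\<And>x. norm (\<phi> x) \<le> C * norm x"
  shows "\<exists>y. \<forall>x. \<phi> x = ip x y"
proof (cases "\<forall>x. \<phi> x = 0")
  case True
  then show ?thesis by (intro exI[of _ 0]) simp
next
  case False
  then obtain x0 where x0: "\<phi> x0 \<noteq> 0" by blast
  have bl: "bounded_linear \<phi>"
    by (rule bounded_linear_intro[where K = C])
      (auto simp: add scale bound mult.commute[of _ C] scaleR_conv_of_real simp flip: scale_of_real)
  have diff: "\<phi> (x - y) = \<phi> x - \<phi> y" for x y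
    using add[of "x - y" y] by simp
  have zero: "\<phi> 0 = 0" using add[of 0 0] by simp
  define K where "K = {x. \<phi> x = 0}"
  have "closed K"
    unfolding K_def by (intro closed_Collect_eq continuous_intros bounded_linear.continuous_on[OF bl])
  then have K: "closed_subspace scl K"
    by (auto simp: closed_subspace_def subspace_def K_def add scale zero)
  obtain p where p: "p \<in> K" "x0 - p \<in> orth_compl ip K" using projection_exists[OF K] by blast
  define u where "u = x0 - p"
  have phiu: "\<phi> u \<noteq> 0" using x0 p by (simp add: u_def diff K_def)
  then have u0: "u \<noteq> 0" using zero by auto
  have "\<phi> x * ip u u = ip x u * \<phi> u" for x
  proof -
    have "scl (\<phi> u) x - scl (\<phi> x) u \<in> K" by (simp add: K_def diff scale)
    then have "ip u (scl (\<phi> u) x - scl (\<phi> x) u) = 0"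
      using p by (simp add: u_def orth_compl_def)
    then have "ip (scl (\<phi> u) x - scl (\<phi> x) u) u = 0" using ip_eq_zero_commute by blast
    then show ?thesis by (simp add: ip_diff_left ip_scale_left algebra_simps)
  qed
  then have "\<phi> x = ip x (scl (rconj (\<phi> u / ip u u)) u)" for x
    using u0 by (simp add: ip_scale_right rconj_rconj ip_self field_simps)
  then show ?thesis by blast
qed

text \<open>Baire's theorem on the closed sets \<open>{x. \<forall>y\<in>F. norm (ip x y) \<le> n}\<close>, which cover the
  space: one of them contains a ball, and testing \<open>y\<close> against a multiple of itself in that ball
  bounds its norm.\<close>

lemma uniform_boundedness:
  assumes pt: "\<And>x. \<exists>C. \<forall>y\<in>F. norm (ip x y) \<le> C"
  shows "\<exists>C. \<forall>y\<in>F. norm y \<le> C"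
proof -
  define E where "E = (\<lambda>n::nat. {x. \<forall>y\<in>F. norm (ip x y) \<le> real n})"
  have E: "closed (E n)" for n
  proof -
    have "E n = (\<Inter>y\<in>F. {x. norm (ip x y) \<le> real n})" by (auto simp: E_def)
    moreover have "closed {x. norm (ip x y) \<le> real n}" for y
      by (intro closed_Collect_le continuous_intros bounded_linear.continuous_on[OF bounded_linear_ip_left])
    ultimately show ?thesis by (simp add: closed_INT)
  qed
  have cover: "(\<Union>n. E n) = UNIV"
  proof -
    have "\<exists>n. x \<in> E n" for x
    proof -
      obtain C where "\<forall>y\<in>F. norm (ip x y) \<le> C" using pt by blast
      moreover obtain n where "C \<le> real n" using real_arch_simple by blast
      ultimately have "x \<in> E n" unfolding E_def by force
      then show ?thesis ..
    qed
    then show ?thesis by blast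
  qed
  have "\<exists>n. interior (E n) \<noteq> {}"
  proof (rule ccontr)
    assume "\<not> ?thesis"
    then have "Met_TC.mtopology interior_of (\<Union>(range E)) = ({} :: 'v set)"
      using E complete_UNIV_space
      by (intro Met_TC.metric_Baire_category_alt) auto
    then show False using cover by simp
  qed
  then obtain n x0 where "x0 \<in> interior (E n)" by blast
  then obtain r where r: "r > 0" "ball x0 r \<subseteq> E n"
    by (meson mem_interior)
  have "norm y \<le> 4 * real n / r" if y: "y \<in> F" for y
  proof (cases "y = 0")
    case False
    define z where "z = (r / (2 * norm y)) *\<^sub>R y"
    have nz: "norm z = r / 2" using False r by (simp add: z_def)
    have "x0 + z \<in> E n" "x0 \<in> E n" using r nz by (auto simp: subset_iff dist_norm)
    then have "norm (ip (x0 + z) y) \<le> real n" "norm (ip x0 y) \<le> real n"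
      using y by (auto simp: E_def)
    then have "norm (ip z y) \<le> 2 * real n"
      using norm_triangle_ineq4[of "ip (x0 + z) y" "ip x0 y"] by (simp add: ip_add_left)
    moreover have "norm (ip z y) = r / 2 * norm y"
      using False r by (simp add: z_def ip_scaleR_left ip_self norm_mult norm_power
        power2_eq_square del: of_real_power)
    ultimately show ?thesis using r by (simp add: field_simps)
  qed (use r in auto)
  then show ?thesis by blast
qed

end

section \<open>Adjoints, closed ranges and the pseudoinverse\<close>

lemma bounded_op_add: "bounded_op s1 s2 A \<Longrightarrow> A (x + y) = A x + A y"
  and bounded_op_scale: "bounded_op s1 s2 A \<Longrightarrow> A (s1 a x) = s2 a (A x)"
  by (simp_all add: bounded_op_def Vector_Spaces.linear_iff)

lemma bounded_op_diff: "bounded_op s1 s2 A \<Longrightarrow> A (x - y) = A x - A y"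
  using bounded_op_add[of s1 s2 A "x - y" y] by simp

lemma bounded_op_zero: "bounded_op s1 s2 A \<Longrightarrow> A 0 = 0"
  using bounded_op_add[of s1 s2 A 0 0] by simp

lemma bounded_op_pos_bound:
  assumes "bounded_op s1 s2 A"
  obtains K where "K > 0" "\<And>x. norm (A x) \<le> K * norm x"
proof -
  obtain K where K: "\<And>x. norm (A x) \<le> K * norm x"
    using assms by (auto simp: bounded_op_def)
  have "norm (A x) \<le> (\<bar>K\<bar> + 1) * norm x" for x
    by (rule order_trans[OF K]) (intro mult_right_mono; simp)
  then show thesis by (intro that[of "\<bar>K\<bar> + 1"]) auto
qed

lemma bounded_op_compose:
  assumes A: "bounded_op s1 s2 A" and B: "bounded_op s2 s3 B"
  shows "bounded_op s1 s3 (B \<circ> A)"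
proof -
  obtain K where K: "K > 0" "\<And>x. norm (B x) \<le> K * norm x"
    by (rule bounded_op_pos_bound[OF B]) blast
  obtain L where L: "L > 0" "\<And>x. norm (A x) \<le> L * norm x"
    by (rule bounded_op_pos_bound[OF A]) blast
  have "norm (B (A x)) \<le> (K * L) * norm x" for x
    using order_trans[OF K(2) mult_left_mono[OF L(2)]] K(1) by (simp add: mult.assoc)
  then show ?thesis
    using A B unfolding bounded_op_def Vector_Spaces.linear_iff by auto
qed

locale hilbert_pair = H1: hilbert_space s1 ip1 + H2: hilbert_space s2 ip2
  for s1 :: "'k::rc_scalar \<Rightarrow> 'a::real_normed_vector \<Rightarrow> 'a" and ip1
    and s2 :: "'k \<Rightarrow> 'b::real_normed_vector \<Rightarrow> 'b" and ip2
begin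

lemma hilbert_pair_swap: "hilbert_pair s2 ip2 s1 ip1"
  by unfold_locales

lemma bounded_opI:
  assumes "\<And>x y. A (x + y) = A x + A y" "\<And>a x. A (s1 a x) = s2 a (A x)"
    "\<And>x. norm (A x) \<le> K * norm x"
  shows "bounded_op s1 s2 A"
  unfolding bounded_op_def Vector_Spaces.linear_iff
  using assms H1.vector_space_axioms H2.vector_space_axioms by blast

lemma bounded_op_scaleR: "bounded_op s1 s2 A \<Longrightarrow> A (r *\<^sub>R x) = r *\<^sub>R A x"
  by (metis bounded_op_scale H1.scale_of_real H2.scale_of_real)

lemma bounded_op_bounded_linear:
  assumes "bounded_op s1 s2 A"
  shows "bounded_linear A"
proof -
  obtain K where K: "K > 0" "\<And>x. norm (A x) \<le> K * norm x"
    by (rule bounded_op_pos_bound[OF assms]) blast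
  show ?thesis
    by (rule bounded_linear_intro[where K = K])
      (auto simp: bounded_op_add[OF assms] bounded_op_scaleR[OF assms] K mult.commute[of _ K])
qed

lemma subspace_range_bounded_op:
  assumes "bounded_op s1 s2 A" "H1.subspace N"
  shows "H2.subspace (A ` N)"
  unfolding H2.subspace_def
proof (intro conjI ballI allI)
  show "0 \<in> A ` N" using bounded_op_zero[OF assms(1)] H1.subspace_0[OF assms(2)] by force
  show "u + v \<in> A ` N" if "u \<in> A ` N" "v \<in> A ` N" for u v
    using that H1.subspace_add[OF assms(2)] by (auto simp flip: bounded_op_add[OF assms(1)])
  show "s2 c u \<in> A ` N" if "u \<in> A ` N" for c u
    using that H1.subspace_scale[OF assms(2)] by (auto simp flip: bounded_op_scale[OF assms(1)])
qed

lemma adjoint_exists: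
  assumes A: "bounded_op s1 s2 A"
  shows "\<exists>A'. bounded_op s2 s1 A' \<and> (\<forall>x y. ip2 (A x) y = ip1 x (A' y))"
proof -
  interpret swap: hilbert_pair s2 ip2 s1 ip1 by (rule hilbert_pair_swap)
  obtain K where K: "K > 0" "\<And>x. norm (A x) \<le> K * norm x"
    by (rule bounded_op_pos_bound[OF A]) blast
  have "\<exists>z. \<forall>x. ip2 (A x) y = ip1 x z" for y
  proof (rule H1.Riesz_representation)
    show "norm (ip2 (A x) y) \<le> (K * norm y) * norm x" for x
      using order_trans[OF H2.Cauchy_Schwarz mult_right_mono[OF K(2)]]
      by (simp add: mult.assoc mult.commute[of "norm y"])
  qed (simp_all add: bounded_op_add[OF A] bounded_op_scale[OF A] H2.ip_add_left H2.ip_scale_left)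
  then obtain A' where A': "\<And>y x. ip2 (A x) y = ip1 x (A' y)" by metis
  have "bounded_op s2 s1 A'"
  proof (rule swap.bounded_opI)
    show "A' (x + y) = A' x + A' y" for x y
      by (rule H1.ip_ext_right) (simp add: A'[symmetric] H1.ip_add_right H2.ip_add_right)
    show "A' (s2 a x) = s1 a (A' x)" for a x
      by (rule H1.ip_ext_right) (simp add: A'[symmetric] H1.ip_scale_right H2.ip_scale_right)
    show "norm (A' y) \<le> K * norm y" for y
    proof (cases "A' y = 0")
      case False
      have "(norm (A' y))\<^sup>2 = norm (ip1 (A' y) (A' y))"
        by (simp add: H1.ip_self norm_power)
      also have "\<dots> = norm (ip2 (A (A' y)) y)" by (simp add: A')
      also have "\<dots> \<le> K * norm (A' y) * norm y"
        by (rule order_trans[OF H2.Cauchy_Schwarz mult_right_mono[OF K(2)]]) simp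
      finally show ?thesis using False by (simp add: power2_eq_square)
    qed (use K(1) in auto)
  qed
  with A' show ?thesis by blast
qed

lemma op_adjoint_eq:
  assumes "\<And>x y. ip2 (A x) y = ip1 x (A' y)"
  shows "op_adjoint ip1 ip2 A = A'"
  unfolding op_adjoint_def
proof (rule the_equality)
  show "S = A'" if "\<forall>x y. ip2 (A x) y = ip1 x (S y)" for S
    using that assms by (intro ext H1.ip_ext_right) metis
qed (use assms in blast)

lemma adjoint_sym:
  assumes "\<And>x y. ip2 (A x) y = ip1 x (A' y)"
  shows "ip1 (A' y) x = ip2 y (A x)"
  by (metis assms H1.ip_commute H2.ip_commute)

text \<open>Uniform boundedness applied to the vectors \<open>y / \<parallel>A' y\<parallel>\<close>: since
  \<open>\<langle>A z, y\<rangle> = \<langle>z, A' y\<rangle>\<close>, each of them pairs with \<open>x\<close> to at most \<open>\<parallel>z\<parallel>\<close>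
  when \<open>x - A z \<bottom> N\<close>. With \<open>N\<close> a closed range \<open>R(A)\<close> this plays the part of the open mapping theorem; it also
  turns the algebraic decomposition \<open>R(A) + N\<^sup>\<bottom> = H\<close> into a quantitative angle condition.\<close>

lemma adjoint_bounded_below:
  assumes A': "bounded_op s2 s1 A'" and adj: "\<And>x y. ip2 (A x) y = ip1 x (A' y)"
    and dec: "\<And>x. \<exists>z. \<forall>y\<in>N. ip2 (x - A z) y = 0"
  shows "\<exists>C>0. \<forall>y\<in>N. norm y \<le> C * norm (A' y)"
proof -
  have dec': "\<exists>z. \<forall>y\<in>N. ip2 x y = ip1 z (A' y)" for x
    using dec[of x] by (simp add: H2.ip_diff_left adj)
  have "\<exists>C. \<forall>u\<in>(\<lambda>y. inverse (norm (A' y)) *\<^sub>R y) ` N. norm u \<le> C"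
  proof (rule H2.uniform_boundedness)
    fix x
    obtain z where z: "\<forall>y\<in>N. ip2 x y = ip1 z (A' y)" using dec' by blast
    have "norm (ip2 x (inverse (norm (A' y)) *\<^sub>R y)) \<le> norm z" if y: "y \<in> N" for y
    proof -
      have "norm (ip2 x y) \<le> norm z * norm (A' y)"
        using z y H1.Cauchy_Schwarz[of z "A' y"] by simp
      moreover have "norm (ip2 x (inverse (norm (A' y)) *\<^sub>R y)) = inverse (norm (A' y)) * norm (ip2 x y)"
        by (simp add: H2.ip_scale_right norm_mult norm_inverse norm_rconj flip: H2.scale_of_real)
      moreover have "inverse (norm (A' y)) * (norm z * norm (A' y)) \<le> norm z"
        by (cases "A' y = 0") (auto simp: field_simps)
      ultimately show ?thesis
        using mult_left_mono[of _ _ "inverse (norm (A' y))"] by (smt (verit) inverse_nonnegative_iff_nonnegative norm_ge_zero)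
    qed
    then show "\<exists>C. \<forall>u\<in>(\<lambda>y. inverse (norm (A' y)) *\<^sub>R y) ` N. norm (ip2 x u) \<le> C" by blast
  qed
  then obtain C where C: "\<And>y. y \<in> N \<Longrightarrow> inverse (norm (A' y)) * norm y \<le> C" by auto
  have "norm y \<le> (\<bar>C\<bar> + 1) * norm (A' y)" if y: "y \<in> N" for y
  proof (cases "A' y = 0")
    case True
    then have "ip2 y y = 0" using dec'[of y] y by force
    then show ?thesis by (simp add: H2.ip_self)
  next
    case False
    then have "norm y \<le> C * norm (A' y)" using C[OF y] by (simp add: field_simps)
    also have "\<dots> \<le> (\<bar>C\<bar> + 1) * norm (A' y)" by (intro mult_right_mono) auto
    finally show ?thesis .
  qed
  then show ?thesis by (intro exI[of _ "\<bar>C\<bar> + 1"]) auto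
qed

lemma closed_image_bounded_below:
  assumes A: "bounded_op s1 s2 A" and N: "closed_subspace s1 N" and "C > 0"
    and C: "\<And>x. x \<in> N \<Longrightarrow> norm x \<le> C * norm (A x)"
  shows "closed_subspace s2 (A ` N)"
proof -
  have sub: "H1.subspace N" and cl: "closed N" using N by (auto simp: closed_subspace_def)
  have "complete (A ` N)"
  proof (rule complete_isometric_image[OF _ _ bounded_op_bounded_linear[OF A]])
    show "0 < inverse C" using \<open>C > 0\<close> by simp
    show "\<forall>x\<in>N. inverse C * norm x \<le> norm (A x)"
      using C \<open>C > 0\<close> by (auto simp: field_simps)
    show "subspace N"
      using H1.subspace_0[OF sub] H1.subspace_add[OF sub] H1.subspace_scaleR[OF sub]
      by (simp add: subspace_def)
    show "complete N" using complete_Int_closed[OF H1.complete_UNIV_space cl] by simp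
  qed
  then show ?thesis
    using subspace_range_bounded_op[OF A sub] by (simp add: closed_subspace_def complete_imp_closed)
qed

lemma adjoint_zero_iff:
  assumes adj: "\<And>x y. ip2 (A x) y = ip1 x (A' y)"
  shows "A' y = 0 \<longleftrightarrow> y \<in> orth_compl ip2 (range A)"
proof
  assume "A' y = 0"
  then have "ip2 (A x) y = 0" for x by (simp add: adj)
  then show "y \<in> orth_compl ip2 (range A)" 
    using H2.ip_eq_zero_commute by (auto simp: orth_compl_def)
next
  assume "y \<in> orth_compl ip2 (range A)"
  then have "ip1 x (A' y) = 0" for x
    using H2.ip_eq_zero_commute by (auto simp: orth_compl_def adj[symmetric])
  then show "A' y = 0" by (intro H1.ip_ext_right) simp
qed

text \<open>The closed range theorem: \<open>A'\<close> vanishes on \<open>R(A)\<^sup>\<bottom>\<close>, so its range is the image of the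
  closed subspace \<open>R(A)\<close>, on which \<open>A'\<close> is bounded below.\<close>

lemma closed_range_adjoint:
  assumes A: "bounded_op s1 s2 A" and A': "bounded_op s2 s1 A'"
    and adj: "\<And>x y. ip2 (A x) y = ip1 x (A' y)" and cl: "closed_subspace s2 (range A)"
  shows "closed_subspace s1 (range A')"
proof -
  interpret swap: hilbert_pair s2 ip2 s1 ip1 by (rule hilbert_pair_swap)
  have dec: "\<exists>z. x - A z \<in> orth_compl ip2 (range A)" for x
    using H2.projection_exists[OF cl] by blast
  have "\<exists>C>0. \<forall>y\<in>range A. norm y \<le> C * norm (A' y)"
    by (rule adjoint_bounded_below[OF A' adj]) (use dec in \<open>auto simp: orth_compl_def\<close>)
  then obtain C where "C > 0" "\<And>y. y \<in> range A \<Longrightarrow> norm y \<le> C * norm (A' y)" by blast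
  then have "closed_subspace s1 (A' ` range A)"
    by (rule swap.closed_image_bounded_below[OF A' cl])
  moreover have "A' ` range A = range A'"
  proof -
    have "A' x \<in> A' ` range A" for x
    proof -
      obtain z where "x - A z \<in> orth_compl ip2 (range A)" using dec by blast
      then have "A' (x - A z) = 0" using adjoint_zero_iff[of A A', OF adj] by simp
      then have "A' x = A' (A z)" by (simp add: bounded_op_diff[OF A'])
      then show ?thesis by blast
    qed
    then show ?thesis by blast
  qed
  ultimately show ?thesis by simp
qed

text \<open>Every \<open>y\<close> has exactly one least-squares solution in \<open>R(A') = (ker A)\<^sup>\<bottom>\<close>, and this
  solution depends linearly on \<open>y\<close>. It is bounded because \<open>A\<close> is bounded below on
  \<open>R(A')\<close>, by the closed range theorem.\<close>

lemma Penrose_inverse_exists: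
  assumes A: "bounded_op s1 s2 A" and cl: "closed_subspace s2 (range A)"
  shows "\<exists>X. bounded_op s2 s1 X \<and> A \<circ> X \<circ> A = A \<and> X \<circ> A \<circ> X = X \<and>
     self_adjoint ip2 (A \<circ> X) \<and> self_adjoint ip1 (X \<circ> A)"
proof -
  interpret swap: hilbert_pair s2 ip2 s1 ip1 by (rule hilbert_pair_swap)
  obtain A' where A': "bounded_op s2 s1 A'" and adj: "\<And>x y. ip2 (A x) y = ip1 x (A' y)"
    using adjoint_exists[OF A] by blast
  have cl': "closed_subspace s1 (range A')" by (rule closed_range_adjoint[OF A A' adj cl])
  have adj': "ip1 (A' y) x = ip2 y (A x)" for x y by (rule adjoint_sym[of A A', OF adj])
  have dec1: "\<exists>p\<in>range A'. x - p \<in> orth_compl ip1 (range A')" for x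
    by (rule H1.projection_exists[OF cl'])
  have "\<exists>C>0. \<forall>x\<in>range A'. norm x \<le> C * norm (A x)"
    by (rule swap.adjoint_bounded_below[OF A adj']) (use dec1 in \<open>auto simp: orth_compl_def\<close>)
  then obtain C where C: "C > 0" "\<And>x. x \<in> range A' \<Longrightarrow> norm x \<le> C * norm (A x)" by blast
  have ker: "A x = 0 \<longleftrightarrow> x \<in> orth_compl ip1 (range A')" for x
    by (rule swap.adjoint_zero_iff[of A' A, OF adj'])
  define sol where "sol = (\<lambda>y x. x \<in> range A' \<and> y - A x \<in> orth_compl ip2 (range A))"
  have subR: "H2.subspace (range A)" "H1.subspace (range A')"
    using cl cl' by (auto simp: closed_subspace_def)
  have ex: "\<exists>x. sol y x" for y
  proof -
    obtain z where z: "y - A z \<in> orth_compl ip2 (range A)"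
      using H2.projection_exists[OF cl] by blast
    obtain p where p: "p \<in> range A'" "z - p \<in> orth_compl ip1 (range A')" using dec1 by blast
    then have "A z = A p" using ker[of "z - p"] by (simp add: bounded_op_diff[OF A])
    with z p show ?thesis by (auto simp: sol_def)
  qed
  have uniq: "x = x'" if "sol y x" "sol y x'" for x x' y
  proof -
    have "A x' - A x \<in> orth_compl ip2 (range A)"
      using H2.subspace_diff[OF H2.subspace_orth_compl, of "y - A x" "range A" "y - A x'"] that
      by (simp add: sol_def)
    moreover have "A x' - A x \<in> range A" by (intro H2.subspace_diff[OF subR(1)]) auto
    ultimately have "A (x' - x) = 0"
      using H2.ip_self[of "A x' - A x"] by (auto simp: orth_compl_def bounded_op_diff[OF A])
    moreover have "x' - x \<in> range A'"
      using that by (intro H1.subspace_diff[OF subR(2)]) (auto simp: sol_def)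
    ultimately have "norm (x' - x) \<le> 0" using C(2)[of "x' - x"] by simp
    then show ?thesis by simp
  qed
  from ex obtain X where X: "\<And>y. sol y (X y)" by metis
  have Xeq: "X y = x" if "sol y x" for x y using uniq[OF X that] .
  have XR: "X y \<in> range A'" and XO: "y - A (X y) \<in> orth_compl ip2 (range A)" for y
    using X by (auto simp: sol_def)
  have ipA: "ip2 (y - A (X y)) (A z) = 0" for y z using XO by (auto simp: orth_compl_def)
  have Xb: "bounded_op s2 s1 X"
  proof (rule swap.bounded_opI)
    show "X (x + y) = X x + X y" for x y
    proof (rule Xeq)
      show "sol (x + y) (X x + X y)"
        using H2.subspace_add[OF H2.subspace_orth_compl XO[of x] XO[of y]]
          H1.subspace_add[OF subR(2) XR[of x] XR[of y]]
        by (simp add: sol_def bounded_op_add[OF A] algebra_simps)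
    qed
    show "X (s2 a y) = s1 a (X y)" for a y
    proof (rule Xeq)
      show "sol (s2 a y) (s1 a (X y))"
        using H2.subspace_scale[OF H2.subspace_orth_compl XO[of y], of a]
          H1.subspace_scale[OF subR(2) XR[of y], of a]
        by (simp add: sol_def bounded_op_scale[OF A] H2.scale_right_diff_distrib)
    qed
    show "norm (X y) \<le> C * norm y" for y
    proof -
      have "(norm y)\<^sup>2 = (norm (y - A (X y)))\<^sup>2 + (norm (A (X y)))\<^sup>2"
        using H2.pythagoras[OF ipA[of y "X y"]] by simp
      then have "norm (A (X y)) \<le> norm y"
        by (metis le_add_same_cancel2 norm_ge_zero power2_le_imp_le zero_le_power2)
      then have "C * norm (A (X y)) \<le> C * norm y" using C(1) by simp
      with C(2)[OF XR[of y]] show ?thesis by linarith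
    qed
  qed
  have AXA: "A (X (A z)) = A z" for z
  proof -
    have "ip2 (A z - A (X (A z))) (A (z - X (A z))) = 0" by (rule ipA)
    then show ?thesis by (simp add: H2.ip_self bounded_op_diff[OF A])
  qed
  have XAX: "X (A (X y)) = X y" for y
    by (rule Xeq) (use XR[of y] H2.subspace_0[OF H2.subspace_orth_compl] in \<open>simp add: sol_def\<close>)
  have sa2: "ip2 (A (X u)) v = ip2 u (A (X v))" for u v
  proof -
    have "ip2 (A (X u)) (v - A (X v)) = 0" using ipA H2.ip_eq_zero_commute by blast
    moreover have "ip2 (u - A (X u)) (A (X v)) = 0" by (rule ipA)
    ultimately show ?thesis by (simp add: H2.ip_diff_left H2.ip_diff_right)
  qed
  have sa1: "ip1 (X (A u)) v = ip1 u (X (A v))" for u v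
  proof -
    have perp: "ip1 (w - X (A w)) (X y) = 0" for w y
    proof -
      have "A (w - X (A w)) = 0" by (simp add: bounded_op_diff[OF A] AXA)
      then show ?thesis using XR[of y] by (auto simp: ker orth_compl_def)
    qed
    have "ip1 (X (A u)) (v - X (A v)) = 0" using perp H1.ip_eq_zero_commute by blast
    moreover have "ip1 (u - X (A u)) (X (A v)) = 0" by (rule perp)
    ultimately show ?thesis by (simp add: H1.ip_diff_left H1.ip_diff_right)
  qed
  show ?thesis
    using Xb AXA XAX sa1 sa2 by (intro exI[of _ X]) (auto simp: self_adjoint_def fun_eq_iff)
qed

text \<open>Two self-adjoint idempotents with the same range, here \<open>A X\<close> and \<open>A Y\<close>, or with the same
  kernel, here \<open>X A\<close> and \<open>Y A\<close>, coincide.\<close>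

lemma Penrose_inverse_unique:
  assumes X: "A \<circ> X \<circ> A = A" "X \<circ> A \<circ> X = X" "self_adjoint ip2 (A \<circ> X)" "self_adjoint ip1 (X \<circ> A)"
    and Y: "A \<circ> Y \<circ> A = A" "Y \<circ> A \<circ> Y = Y" "self_adjoint ip2 (A \<circ> Y)" "self_adjoint ip1 (Y \<circ> A)"
  shows "X = Y"
proof -
  have X': "A (X (A z)) = A z" "X (A (X y)) = X y" "ip2 (A (X y)) y' = ip2 y (A (X y'))"
      "ip1 (X (A z)) z' = ip1 z (X (A z'))" for y y' z z'
    using X by (auto simp: fun_eq_iff self_adjoint_def)
  have Y': "A (Y (A z)) = A z" "Y (A (Y y)) = Y y" "ip2 (A (Y y)) y' = ip2 y (A (Y y'))"
      "ip1 (Y (A z)) z' = ip1 z (Y (A z'))" for y y' z z'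
    using Y by (auto simp: fun_eq_iff self_adjoint_def)
  have AXY: "A (X y) = A (Y y)" for y
    by (rule H2.ip_ext) (metis X'(1,3) Y'(1,3))
  have XYA: "X (A z) = Y (A z)" for z
    by (rule H1.ip_ext) (metis X'(1,4) Y'(1,4))
  show ?thesis
  proof
    show "X y = Y y" for y by (metis X'(2) Y'(2) AXY XYA)
  qed
qed

lemma pseudoinverse_Penrose:
  assumes "bounded_op s1 s2 A" and "closed_subspace s2 (range A)"
  defines "X \<equiv> pseudoinverse s1 ip1 s2 ip2 A"
  shows "bounded_op s2 s1 X" and "A \<circ> X \<circ> A = A" and "X \<circ> A \<circ> X = X"
    and "self_adjoint ip2 (A \<circ> X)"
proof -
  let ?P = "\<lambda>X. bounded_op s2 s1 X \<and> A \<circ> X \<circ> A = A \<and> X \<circ> A \<circ> X = X \<and>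
     self_adjoint ip2 (A \<circ> X) \<and> self_adjoint ip1 (X \<circ> A)"
  have "\<exists>!X. ?P X"
    using Penrose_inverse_exists[OF assms(1,2)] Penrose_inverse_unique by (intro ex_ex1I) auto
  from theI'[OF this] show "bounded_op s2 s1 X" "A \<circ> X \<circ> A = A" "X \<circ> A \<circ> X = X"
    "self_adjoint ip2 (A \<circ> X)"
    unfolding X_def pseudoinverse_def by auto
qed

end

section \<open>The Hilbert space of square-summable sequences\<close>

lemma coord_add: "coord (a + b) n = coord a n + coord b n"
  by transfer simp

lemma coord_diff: "coord (a - b) n = coord a n - coord b n"
  by transfer simp

lemma coord_scale: "coord (ell2_scale c a) n = c * coord a n"
  by transfer simp

lemma coord_basis: "coord (ell2_basis n :: 'k::rc_scalar ell2) m = (if m = n then 1 else 0)"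
  by transfer simp

lemma coord_ext: "(\<And>n. coord a n = coord b n) \<Longrightarrow> a = b"
  by (metis coord_inject ext)

lemma summable_coord: "summable (\<lambda>n. (norm (coord a n))\<^sup>2)"
  using coord[of a] by simp

lemma norm_ell2_sq: "(norm a)\<^sup>2 = (\<Sum>n. (norm (coord a n))\<^sup>2)"
  by (simp add: norm_ell2.rep_eq suminf_nonneg summable_coord)

lemma norm_coord_le: "norm (coord a n) \<le> norm a"
proof -
  have "(\<Sum>i\<in>{n}. (norm (coord a i))\<^sup>2) \<le> (\<Sum>i. (norm (coord a i))\<^sup>2)"
    by (rule sum_le_suminf[OF summable_coord]) auto
  then have "(norm (coord a n))\<^sup>2 \<le> (norm a)\<^sup>2" by (simp add: norm_ell2_sq)
  then show ?thesis by (rule power2_le_imp_le) simp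
qed

lemma ell2_ip_basis: "ell2_ip a (ell2_basis n) = coord a n"
proof -
  have "ell2_ip a (ell2_basis n) = (\<Sum>m. if m = n then coord a m else 0)"
    unfolding ell2_ip.rep_eq coord_basis using rconj_of_real[of 1, where 'k = 'a]
    by (intro suminf_cong) (auto simp del: rconj_of_real)
  also have "\<dots> = coord a n" by (rule sums_unique[symmetric, OF sums_single])
  finally show ?thesis .
qed

text \<open>A Cauchy sequence converges coordinatewise. Passing to the limit in the partial sums of
  \<open>\<parallel>x\<^sub>k - x\<^sub>l\<parallel>\<^sup>2\<close> bounds those of \<open>\<parallel>x\<^sub>k - b\<parallel>\<^sup>2\<close>, which yields both that the
  coordinatewise limit \<open>b\<close> is square summable and that convergence holds in norm.\<close>

lemma hilbert_space_ell2: "hilbert_space (ell2_scale :: 'k::rc_scalar \<Rightarrow> _) ell2_ip"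
proof unfold_locales
  show "complete (UNIV :: 'k ell2 set)"
    unfolding complete_def
  proof (intro allI impI, elim conjE)
    fix x :: "nat \<Rightarrow> 'k ell2" assume C: "Cauchy x"
    have "Cauchy (\<lambda>k. coord (x k) n)" for n
    proof (rule metric_CauchyI)
      fix r :: real assume "0 < r"
      then obtain N where "\<And>k l. k \<ge> N \<Longrightarrow> l \<ge> N \<Longrightarrow> dist (x k) (x l) < r"
        using metric_CauchyD[OF C] by blast
      then show "\<exists>N. \<forall>k\<ge>N. \<forall>l\<ge>N. dist (coord (x k) n) (coord (x l) n) < r"
        by (intro exI[of _ N])
          (auto simp: dist_norm simp flip: coord_diff intro: le_less_trans[OF norm_coord_le])
    qed
    then have "\<exists>l. (\<lambda>k. coord (x k) n) \<longlonglongrightarrow> l" for n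
      by (simp add: Cauchy_convergent_iff convergent_def)
    then obtain b where b: "\<And>n. (\<lambda>k. coord (x k) n) \<longlonglongrightarrow> b n" by metis
    have part: "\<exists>N. \<forall>k\<ge>N. \<forall>m. (\<Sum>n<m. (norm (coord (x k) n - b n))\<^sup>2) \<le> r\<^sup>2" if r: "r > 0" for r
    proof -
      obtain N where N: "\<And>k l. k \<ge> N \<Longrightarrow> l \<ge> N \<Longrightarrow> dist (x k) (x l) < r"
        using metric_CauchyD[OF C] r by blast
      have "(\<Sum>n<m. (norm (coord (x k) n - b n))\<^sup>2) \<le> r\<^sup>2" if k: "k \<ge> N" for k m
      proof (rule LIMSEQ_le_const2)
        show "(\<lambda>l. \<Sum>n<m. (norm (coord (x k) n - coord (x l) n))\<^sup>2)
            \<longlonglongrightarrow> (\<Sum>n<m. (norm (coord (x k) n - b n))\<^sup>2)"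
          by (intro tendsto_intros b)
        have "(\<Sum>n<m. (norm (coord (x k) n - coord (x l) n))\<^sup>2) \<le> r\<^sup>2" if "l \<ge> N" for l
        proof -
          have "(\<Sum>n<m. (norm (coord (x k - x l) n))\<^sup>2) \<le> (norm (x k - x l))\<^sup>2"
            unfolding norm_ell2_sq by (rule sum_le_suminf[OF summable_coord]) auto
          also have "\<dots> \<le> r\<^sup>2"
            using N[OF k that] by (intro power_mono) (auto simp: dist_norm)
          finally show ?thesis by (simp add: coord_diff)
        qed
        then show "\<exists>N. \<forall>l\<ge>N. (\<Sum>n<m. (norm (coord (x k) n - coord (x l) n))\<^sup>2) \<le> r\<^sup>2" by blast
      qed
      then show ?thesis by blast
    qed
    have summ: "summable (\<lambda>n. (norm (coord (x k) n - b n))\<^sup>2)"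
      if "\<forall>m. (\<Sum>n<m. (norm (coord (x k) n - b n))\<^sup>2) \<le> c" for k c
      by (rule bounded_imp_summable[where B = c]) (use that in \<open>auto simp flip: lessThan_Suc_atMost simp del: sum.lessThan_Suc\<close>)
    obtain k where "\<forall>m. (\<Sum>n<m. (norm (coord (x k) n - b n))\<^sup>2) \<le> 1\<^sup>2"
      using part[of 1] by fastforce
    from square_summable_add[OF summable_coord[of "- x k"] summ[OF this]]
    have "summable (\<lambda>n. (norm (- b n))\<^sup>2)" by (simp add: uminus_ell2.rep_eq)
    then have bs: "coord (Abs_ell2 b) = b" by (intro Abs_ell2_inverse) simp
    have "x \<longlonglongrightarrow> Abs_ell2 b"
    proof (rule metric_LIMSEQ_I)
      fix r :: real assume r: "0 < r"
      then obtain N where N: "\<And>k m. k \<ge> N \<Longrightarrow> (\<Sum>n<m. (norm (coord (x k) n - b n))\<^sup>2) \<le> (r / 2)\<^sup>2"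
        using part[of "r / 2"] by auto
      have "dist (x k) (Abs_ell2 b) < r" if "k \<ge> N" for k
      proof -
        have "(norm (x k - Abs_ell2 b))\<^sup>2 \<le> (r / 2)\<^sup>2"
          unfolding norm_ell2_sq coord_diff bs
          by (rule suminf_le_const[OF summ]) (use N that in auto)
        then have "norm (x k - Abs_ell2 b) \<le> r / 2"
          by (rule power2_le_imp_le) (use r in simp)
        then show ?thesis using r by (simp add: dist_norm)
      qed
      then show "\<exists>N. \<forall>k\<ge>N. dist (x k) (Abs_ell2 b) < r" by blast
    qed
    then show "\<exists>l\<in>UNIV. x \<longlonglongrightarrow> l" by blast
  qed
qed

lemma ell2_basis_expansion: "(\<lambda>n. ell2_scale (coord a n) (ell2_basis n)) sums a"
proof -
  define P where "P = (\<lambda>N. \<Sum>n<N. ell2_scale (coord a n) (ell2_basis n))"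
  have cP: "coord (P N) m = (if m < N then coord a m else 0)" for N m
  proof (induction N)
    case 0
    then show ?case by (simp add: P_def zero_ell2.rep_eq)
  next
    case (Suc N)
    then show ?case by (auto simp: P_def coord_add coord_scale coord_basis less_Suc_eq)
  qed
  have tail: "(norm (a - P N))\<^sup>2 = (norm a)\<^sup>2 - (\<Sum>n<N. (norm (coord a n))\<^sup>2)" for N
  proof -
    have "(norm a)\<^sup>2 = (\<Sum>n. (norm (coord a (n + N)))\<^sup>2) + (\<Sum>n<N. (norm (coord a n))\<^sup>2)"
      unfolding norm_ell2_sq by (rule suminf_split_initial_segment[OF summable_coord])
    moreover have "(norm (a - P N))\<^sup>2 = (\<Sum>n. (norm (coord (a - P N) (n + N)))\<^sup>2)
        + (\<Sum>n<N. (norm (coord (a - P N) n))\<^sup>2)"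
      unfolding norm_ell2_sq by (rule suminf_split_initial_segment[OF summable_coord])
    ultimately show ?thesis by (simp add: coord_diff cP)
  qed
  have "(\<lambda>N. (norm a)\<^sup>2 - (\<Sum>n<N. (norm (coord a n))\<^sup>2)) \<longlonglongrightarrow> (norm a)\<^sup>2 - (norm a)\<^sup>2"
    by (intro tendsto_diff tendsto_const) (simp add: norm_ell2_sq summable_LIMSEQ[OF summable_coord])
  then have "(\<lambda>N. sqrt ((norm (a - P N))\<^sup>2)) \<longlonglongrightarrow> sqrt 0"
    unfolding tail by (intro tendsto_real_sqrt) simp
  then have "(\<lambda>N. norm (P N - a)) \<longlonglongrightarrow> 0" by (simp add: norm_minus_commute)
  then show ?thesis unfolding sums_def P_def[symmetric] by (simp add: LIM_zero_cancel tendsto_norm_zero_iff)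
qed

section \<open>Square roots of positive diagonal operators\<close>

text \<open>The pointwise product is square summable for bounded \<open>r\<close>; otherwise \<open>Abs_ell2\<close> may be
  applied outside its domain, so the lemmas about this operator assume boundedness.\<close>

definition diag_op :: "(nat \<Rightarrow> real) \<Rightarrow> 'k::rc_scalar ell2 \<Rightarrow> 'k ell2" where
  "diag_op r a = Abs_ell2 (\<lambda>n. r n *\<^sub>R coord a n)"

lemma coord_diag_op:
  assumes "bounded (range r)"
  shows "coord (diag_op r a) n = r n *\<^sub>R coord a n"
proof -
  obtain K where K: "\<And>n. \<bar>r n\<bar> \<le> K" using assms by (auto simp: bounded_iff)
  have "summable (\<lambda>n. (norm (r n *\<^sub>R coord a n))\<^sup>2)"
  proof (rule summable_comparison_test')
    show "summable (\<lambda>n. K\<^sup>2 * (norm (coord a n))\<^sup>2)" by (intro summable_mult summable_coord)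
    have "\<bar>r n\<bar>\<^sup>2 \<le> K\<^sup>2" for n by (intro power_mono K) simp
    then show "norm ((norm (r n *\<^sub>R coord a n))\<^sup>2) \<le> K\<^sup>2 * (norm (coord a n))\<^sup>2" for n
      by (simp add: power_mult_distrib mult_right_mono)
  qed
  then show ?thesis unfolding diag_op_def by (simp add: Abs_ell2_inverse)
qed

lemma bounded_op_diag_op:
  assumes "bounded (range r)"
  shows "bounded_op ell2_scale ell2_scale (diag_op r)"
proof -
  interpret hilbert_pair ell2_scale ell2_ip ell2_scale ell2_ip
    by (intro hilbert_pair.intro hilbert_space_ell2)
  obtain K where K: "\<And>n. \<bar>r n\<bar> \<le> K" using assms by (auto simp: bounded_iff)
  have K0: "0 \<le> K" using K[of 0] by linarith
  show ?thesis
  proof (rule bounded_opI)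
    show "diag_op r (x + y) = diag_op r x + diag_op r y" for x y :: "'a ell2"
      by (rule coord_ext) (simp add: coord_diag_op[OF assms] coord_add scaleR_add_right)
    show "diag_op r (ell2_scale c x) = ell2_scale c (diag_op r x)" for c and x :: "'a ell2"
      by (rule coord_ext) (simp add: coord_diag_op[OF assms] coord_scale)
    show "norm (diag_op r x) \<le> K * norm x" for x :: "'a ell2"
    proof (rule power2_le_imp_le)
      have "\<bar>r n\<bar>\<^sup>2 \<le> K\<^sup>2" for n by (intro power_mono K) simp
      then have "(norm (diag_op r x))\<^sup>2 \<le> (\<Sum>n. K\<^sup>2 * (norm (coord x n))\<^sup>2)"
        unfolding norm_ell2_sq[of "diag_op r x"]
        by (intro suminf_le summable_coord summable_mult)
          (simp add: coord_diag_op[OF assms] power_mult_distrib mult_right_mono)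
      also have "\<dots> = (K * norm x)\<^sup>2"
        by (simp add: suminf_mult[OF summable_coord] power_mult_distrib norm_ell2_sq)
      finally show "(norm (diag_op r x))\<^sup>2 \<le> (K * norm x)\<^sup>2" .
    qed (simp add: K0)
  qed
qed

lemma diag_op_self_adjoint:
  assumes "bounded (range r)"
  shows "ell2_ip (diag_op r a) b = ell2_ip a (diag_op r b)"
  unfolding ell2_ip.rep_eq coord_diag_op[OF assms]
  by (simp add: scaleR_conv_of_real rconj_mult algebra_simps)

lemma rpart_ip_diag_op:
  assumes "bounded (range r)"
  shows "rpart (ell2_ip (diag_op r a) a) = (\<Sum>n. r n * (norm (coord a n))\<^sup>2)"
    and "summable (\<lambda>n. r n * (norm (coord a n))\<^sup>2)"
proof -
  obtain K where K: "\<And>n. \<bar>r n\<bar> \<le> K" using assms by (auto simp: bounded_iff)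
  show s: "summable (\<lambda>n. r n * (norm (coord a n))\<^sup>2)"
  proof (rule summable_comparison_test')
    show "summable (\<lambda>n. K * (norm (coord a n))\<^sup>2)" by (intro summable_mult summable_coord)
    show "norm (r n * (norm (coord a n))\<^sup>2) \<le> K * (norm (coord a n))\<^sup>2" for n
      by (simp add: abs_mult K mult_right_mono)
  qed
  have "ell2_ip (diag_op r a) a = (\<Sum>n. of_real (r n * (norm (coord a n))\<^sup>2))"
    unfolding ell2_ip.rep_eq coord_diag_op[OF assms]
    by (simp add: scaleR_conv_of_real mult_rconj mult.assoc)
  also have "\<dots> = of_real (\<Sum>n. r n * (norm (coord a n))\<^sup>2)"
    by (rule bounded_linear.suminf[OF bounded_linear_of_real s, symmetric])
  finally show "rpart (ell2_ip (diag_op r a) a) = (\<Sum>n. r n * (norm (coord a n))\<^sup>2)" by simp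
qed

lemma diag_op_eq_zero_if_ip_zero:
  assumes "bounded (range r)" "\<And>n. 0 < r n" "rpart (ell2_ip (diag_op r a) a) = 0"
  shows "a = 0"
proof -
  have "\<forall>n. r n * (norm (coord a n))\<^sup>2 = 0"
    using assms(3) rpart_ip_diag_op[OF assms(1), of a] assms(2)
    by (simp add: suminf_eq_zero_iff less_imp_le)
  moreover have "r n \<noteq> 0" for n using assms(2)[of n] by simp
  ultimately show ?thesis by (intro coord_ext) (simp add: zero_ell2.rep_eq)
qed

text \<open>Self-adjointness lets \<open>D\<close> act on arbitrary vectors coordinate by coordinate:
  \<open>\<langle>D x, e\<^sub>n\<rangle> = \<langle>x, D e\<^sub>n\<rangle>\<close>. The inverse of \<open>D\<close> bounds the diagonal
  entries away from zero.\<close>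

lemma diag_ops_eq_diag_op:
  assumes "D \<in> diag_ops"
  shows "\<exists>r. D = diag_op r \<and> bounded (range r) \<and> (\<forall>n. 0 < r n) \<and> bounded (range (\<lambda>n. 1 / r n))"
proof -
  have D: "bounded_op ell2_scale ell2_scale D" and
    sa: "\<And>x y. ell2_ip (D x) y = ell2_ip x (D y)" and
    pos: "\<And>x. x \<noteq> 0 \<Longrightarrow> 0 < rpart (ell2_ip (D x) x)"
    using assms by (auto simp: diag_ops_def positive_def_def self_adjoint_def invertible_op_def)
  obtain C where C: "bounded_op ell2_scale ell2_scale C" and CD: "\<And>x. C (D x) = x"
    using assms by (auto simp: diag_ops_def invertible_op_def fun_eq_iff)
  obtain d where d: "\<And>n. D (ell2_basis n) = ell2_scale (d n) (ell2_basis n)"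
    using assms unfolding diag_ops_def mem_Collect_eq by metis
  have bb: "ell2_ip (ell2_basis n) (ell2_basis n) = (1::'a)" for n
    by (simp add: ell2_ip_basis coord_basis)
  have "rconj (d n) = d n" for n
    using sa[of "ell2_basis n" "ell2_basis n"]
    by (simp add: d ell2.ip_scale_left ell2.ip_scale_right bb)
  then have dr: "d n = of_real (rpart (d n))" for n by (rule rconj_fixed_is_real)
  define r where "r = (\<lambda>n. rpart (d n))"
  have Dr: "D (ell2_basis n) = r n *\<^sub>R ell2_basis n" for n
    using d[of n] dr[of n] by (simp add: r_def flip: ell2.scale_of_real)
  have nb: "norm (ell2_basis n :: 'a ell2) = 1" for n
  proof -
    have "(of_real ((norm (ell2_basis n :: 'a ell2))\<^sup>2) :: 'a) = of_real 1"
      using bb[of n] unfolding ell2.ip_self by simp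
    then have "(norm (ell2_basis n :: 'a ell2))\<^sup>2 = 1" unfolding of_real_eq_iff .
    then show ?thesis by (simp add: power2_eq_1_iff) (metis norm_ge_zero neg_0_le_iff_le not_one_le_zero)
  qed
  have r0: "0 < r n" for n
  proof -
    have "(ell2_basis n :: 'a ell2) \<noteq> 0" using nb[of n] by auto
    from pos[OF this] show ?thesis by (simp add: d ell2.ip_scale_left bb r_def)
  qed
  interpret hilbert_pair ell2_scale ell2_ip "ell2_scale :: 'a \<Rightarrow> _" ell2_ip
    by (intro hilbert_pair.intro hilbert_space_ell2)
  obtain K where K: "\<And>x. norm (D x) \<le> K * norm x" by (rule bounded_op_pos_bound[OF D]) blast
  obtain L where L: "\<And>x. norm (C x) \<le> L * norm x" by (rule bounded_op_pos_bound[OF C]) blast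
  have br: "bounded (range r)"
    using K[of "ell2_basis _"] by (intro boundedI[where B = K]) (auto simp: Dr nb)
  have "norm (1 / r n) \<le> L" for n
  proof -
    have "1 = norm (C (r n *\<^sub>R ell2_basis n))" by (simp add: CD nb flip: Dr)
    also have "\<dots> \<le> L * r n" using L[of "r n *\<^sub>R ell2_basis n"] r0[of n] by (simp add: nb)
    finally show ?thesis using r0[of n] by (simp add: field_simps)
  qed
  then have bir: "bounded (range (\<lambda>n. 1 / r n))" by (intro boundedI) auto
  have "D x = diag_op r x" for x
  proof (rule coord_ext)
    fix n
    have "coord (D x) n = ell2_ip x (r n *\<^sub>R ell2_basis n)" by (simp add: sa Dr flip: ell2_ip_basis)
    also have "\<dots> = r n *\<^sub>R coord x n"
      by (simp add: ell2.ip_scale_right ell2_ip_basis scaleR_conv_of_real flip: ell2.scale_of_real)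
    finally show "coord (D x) n = coord (diag_op r x) n" by (simp add: coord_diag_op br)
  qed
  then have "D = diag_op r" by blast
  with br r0 bir show ?thesis by blast
qed

lemma bounded_range_sqrt:
  assumes "bounded (range r)" "\<And>n. 0 \<le> r n"
  shows "bounded (range (\<lambda>n::nat. sqrt (r n)))"
proof -
  obtain K where "\<And>n. \<bar>r n\<bar> \<le> K" using assms(1) by (auto simp: bounded_iff)
  then have "r n \<le> K" for n by (meson abs_le_D1)
  then show ?thesis by (intro boundedI[where B = "sqrt K"]) (auto simp: assms(2))
qed

text \<open>A positive square root \<open>R\<close> commutes with \<open>R\<^sup>2 = D\<close>, so \<open>R e\<^sub>n\<close> lies in the eigenspace of
  \<open>D\<close> that contains \<open>e\<^sub>n\<close>, on which \<open>S = diag (\<surd>r)\<close> is a scalar; hence \<open>R\<close> and \<open>S\<close> commute. Then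
  \<open>(R + S)(R - S) = 0\<close>, and pairing with \<open>y = (R - S) x\<close> gives
  \<open>\<langle>R y, y\<rangle> + \<langle>S y, y\<rangle> = 0\<close> with both terms nonnegative and \<open>S\<close> definite.\<close>

lemma op_sqrt_diag_op:
  assumes br: "bounded (range r)" and r0: "\<And>n. 0 < r n"
  shows "op_sqrt (ell2_scale :: 'k::rc_scalar \<Rightarrow> _) ell2_ip (diag_op r) = diag_op (\<lambda>n. sqrt (r n))"
  unfolding op_sqrt_def
proof (rule the_equality)
  interpret hilbert_pair ell2_scale ell2_ip "ell2_scale :: 'k \<Rightarrow> _" ell2_ip
    by (intro hilbert_pair.intro hilbert_space_ell2)
  define S :: "'k ell2 \<Rightarrow> 'k ell2" where "S = diag_op (\<lambda>n. sqrt (r n))"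
  have bs: "bounded (range (\<lambda>n. sqrt (r n)))"
    by (intro bounded_range_sqrt br less_imp_le r0)
  have Sb: "bounded_op ell2_scale ell2_scale S" unfolding S_def by (rule bounded_op_diag_op[OF bs])
  have SS: "S (S x) = diag_op r x" for x
    by (rule coord_ext) (simp add: S_def coord_diag_op bs br r0 less_imp_le)
  have Spos: "0 \<le> rpart (ell2_ip (S x) x)" for x
    unfolding S_def rpart_ip_diag_op(1)[OF bs]
    by (intro suminf_nonneg rpart_ip_diag_op(2)[OF bs]) (simp add: r0 less_imp_le)
  show "bounded_op ell2_scale ell2_scale S \<and> positive_semidef ell2_ip S \<and> S \<circ> S = diag_op r"
    using Sb Spos SS diag_op_self_adjoint[OF bs]
    by (auto simp: positive_semidef_def self_adjoint_def fun_eq_iff S_def)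
  fix R :: "'k ell2 \<Rightarrow> 'k ell2"
  assume "bounded_op ell2_scale ell2_scale R \<and> positive_semidef ell2_ip R \<and> R \<circ> R = diag_op r"
  then have Rb: "bounded_op ell2_scale ell2_scale R" and RR: "\<And>x. R (R x) = diag_op r x"
    and Rpos: "\<And>x. 0 \<le> rpart (ell2_ip (R x) x)" and Rsa: "\<And>x y. ell2_ip (R x) y = ell2_ip x (R y)"
    by (auto simp: positive_semidef_def self_adjoint_def fun_eq_iff)
  have basis_eig: "diag_op q (ell2_basis n) = q n *\<^sub>R (ell2_basis n :: 'k ell2)"
    if "bounded (range q)" for q n
    by (rule coord_ext) (simp add: coord_diag_op[OF that] coord_basis scaleR_ell2.rep_eq)
  have comm_basis: "S (R (ell2_basis n)) = R (S (ell2_basis n))" for n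
  proof (rule coord_ext)
    fix m
    have "diag_op r (R (ell2_basis n)) = R (diag_op r (ell2_basis n))" by (simp flip: RR)
    also have "\<dots> = r n *\<^sub>R R (ell2_basis n)"
      by (simp add: basis_eig[OF br] bounded_op_scaleR[OF Rb])
    finally have "coord (diag_op r (R (ell2_basis n))) m = coord (r n *\<^sub>R R (ell2_basis n)) m" by simp
    then have "r m = r n \<or> coord (R (ell2_basis n)) m = 0"
      by (auto simp: coord_diag_op[OF br] scaleR_ell2.rep_eq)
    then show "coord (S (R (ell2_basis n))) m = coord (R (S (ell2_basis n))) m"
      by (auto simp: S_def basis_eig[OF bs] bounded_op_scaleR[OF Rb] coord_diag_op[OF bs]
          scaleR_ell2.rep_eq)
  qed
  have comm: "S (R x) = R (S x)" for x
  proof (rule coord_ext)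
    fix n
    have "coord (S (R x)) n = ell2_ip x (R (S (ell2_basis n)))"
      unfolding ell2_ip_basis[symmetric] using diag_op_self_adjoint[OF bs] Rsa by (metis S_def)
    also have "\<dots> = coord (R (S x)) n"
      unfolding ell2_ip_basis[symmetric] comm_basis[symmetric]
      using diag_op_self_adjoint[OF bs] Rsa by (metis S_def)
    finally show "coord (S (R x)) n = coord (R (S x)) n" .
  qed
  have "R x = S x" for x
  proof -
    define y where "y = R x - S x"
    have "R y + S y = 0"
      by (simp add: y_def bounded_op_diff[OF Rb] bounded_op_diff[OF Sb] RR SS comm)
    then have "rpart (ell2_ip (R y) y) + rpart (ell2_ip (S y) y) = 0"
      by (simp flip: rpart_add ell2.ip_add_left)
    then have "rpart (ell2_ip (S y) y) = 0" using Rpos[of y] Spos[of y] by linarith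
    then have "y = 0"
      by (intro diag_op_eq_zero_if_ip_zero[OF bs]) (simp_all add: r0 S_def)
    then show ?thesis by (simp add: y_def)
  qed
  then show "R = S" by blast
qed

lemma diag_ops_sqrt:
  fixes D :: "'k::rc_scalar ell2 \<Rightarrow> 'k ell2"
  assumes "D \<in> diag_ops"
  defines "E \<equiv> op_inv_sqrt ell2_scale ell2_ip D"
  obtains S where "bounded_op ell2_scale ell2_scale S" "bounded_op ell2_scale ell2_scale E"
    "\<And>x y. ell2_ip (S x) y = ell2_ip x (S y)"
    "\<And>x. S (E x) = x" "\<And>x. E (S x) = x" "\<And>x. D x = S (S x)"
proof -
  obtain r where D: "D = diag_op r" and br: "bounded (range r)" and r0: "\<And>n. 0 < r n"
    and bir: "bounded (range (\<lambda>n. 1 / r n))"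
    using diag_ops_eq_diag_op[OF assms(1)] by blast
  define S :: "'k ell2 \<Rightarrow> 'k ell2" where "S = diag_op (\<lambda>n. sqrt (r n))"
  define F :: "'k ell2 \<Rightarrow> 'k ell2" where "F = diag_op (\<lambda>n. sqrt (1 / r n))"
  have bs: "bounded (range (\<lambda>n. sqrt (r n)))" and bi: "bounded (range (\<lambda>n. sqrt (1 / r n)))"
    using bounded_range_sqrt[OF br] bounded_range_sqrt[OF bir] r0 by (auto simp: less_imp_le)
  have ne: "sqrt (r n) \<noteq> 0" for n using r0[of n] by simp
  have SF: "S (F x) = x" and FS: "F (S x) = x" for x
    using ne by (auto intro!: coord_ext simp: S_def F_def coord_diag_op[OF bs] coord_diag_op[OF bi]
        simp flip: real_sqrt_mult)
  have "op_inv_sqrt ell2_scale ell2_ip D = inv S"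
    unfolding op_inv_sqrt_def D op_sqrt_diag_op[OF br r0] S_def ..
  also have "inv S = F" by (rule inv_equality) (simp_all add: SF FS)
  finally have EF: "E = F" by (simp add: E_def)
  have DSS: "D x = S (S x)" for x
    by (rule coord_ext) (simp add: D S_def coord_diag_op[OF bs] coord_diag_op[OF br] r0 less_imp_le)
  show thesis
    by (rule that[of S])
      (simp_all only: EF SF FS DSS S_def F_def bounded_op_diag_op[OF bs] bounded_op_diag_op[OF bi]
        diag_op_self_adjoint[OF bs]
        SF[unfolded S_def F_def] FS[unfolded S_def F_def] DSS[unfolded S_def])
qed

section \<open>The synthesis operator of a frame\<close>

locale ell2_hilbert_pair = hilbert_space scl ip
  for scl :: "'k::rc_scalar \<Rightarrow> 'v::real_normed_vector \<Rightarrow> 'v" and ip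
begin

sublocale synth: hilbert_pair ell2_scale ell2_ip scl ip
  by (intro hilbert_pair.intro hilbert_space_ell2 hilbert_space_axioms)

sublocale anal: hilbert_pair scl ip ell2_scale ell2_ip
  by (rule synth.hilbert_pair_swap)

lemma bounded_op_basis_sums:
  assumes T: "bounded_op ell2_scale scl T"
  shows "(\<lambda>n. scl (coord a n) (T (ell2_basis n))) sums T a"
  using bounded_linear.sums[OF synth.bounded_op_bounded_linear[OF T] ell2_basis_expansion[of a]]
  by (simp add: bounded_op_scale[OF T])

lemma coord_adjoint:
  assumes "\<And>x y. ip (T x) y = ell2_ip x (T' y)"
  shows "coord (T' h) n = ip h (T (ell2_basis n))"
  unfolding ell2_ip_basis[symmetric] by (rule synth.adjoint_sym[of T T', OF assms])

lemma synthesis_eq: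
  assumes "bounded_op ell2_scale scl T" and "\<And>n. T (ell2_basis n) = f n"
  shows "synthesis scl f = T"
  unfolding synthesis_def
proof (rule the_equality)
  fix T1 assume T1: "bounded_op ell2_scale scl T1 \<and> (\<forall>n. T1 (ell2_basis n) = f n)"
  show "T1 = T"
  proof
    fix a
    have "(\<lambda>n. scl (coord a n) (f n)) sums T1 a" "(\<lambda>n. scl (coord a n) (f n)) sums T a"
      using bounded_op_basis_sums[of T1 a] bounded_op_basis_sums[OF assms(1), of a] T1 assms(2)
      by auto
    then show "T1 a = T a" by (rule sums_unique2)
  qed
qed (use assms in blast)

text \<open>The analysis operator \<open>T' h = (\<langle>h, f\<^sub>n\<rangle>)\<^sub>n\<close> sees only the component of \<open>h\<close> in \<open>W\<close>, so
  the frame inequalities make it bounded on the whole space and bounded below on \<open>W\<close>. Its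
  adjoint sends \<open>e\<^sub>n\<close> to \<open>f\<^sub>n\<close> and hence is the synthesis operator; the lower frame bound closes
  \<open>R(T')\<close>, the closed range theorem closes \<open>R(T)\<close>, and so
  \<open>R(T) = (ker T')\<^sup>\<bottom> = W\<close>.\<close>

lemma frame_synthesis:
  assumes W: "closed_subspace scl W" and fr: "frame_for ip f W"
  obtains T' where "bounded_op scl ell2_scale T'" and "bounded_op ell2_scale scl (synthesis scl f)"
    "\<And>n. synthesis scl f (ell2_basis n) = f n"
    "\<And>x y. ip (synthesis scl f x) y = ell2_ip x (T' y)" "range (synthesis scl f) = W"
proof -
  have fW: "f n \<in> W" for n using fr unfolding frame_for_def by auto
  obtain A B where A: "A > 0" and B: "B > 0" and AB: "\<forall>h\<in>W. summable (\<lambda>n. (norm (ip h (f n)))\<^sup>2) \<and>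
      A * (norm h)\<^sup>2 \<le> (\<Sum>n. (norm (ip h (f n)))\<^sup>2) \<and>
      (\<Sum>n. (norm (ip h (f n)))\<^sup>2) \<le> B * (norm h)\<^sup>2"
    using fr unfolding frame_for_def by (elim conjE exE) (rule that; assumption)
  have summ: "summable (\<lambda>n. (norm (ip h (f n)))\<^sup>2)"
    and lower: "A * (norm h)\<^sup>2 \<le> (\<Sum>n. (norm (ip h (f n)))\<^sup>2)"
    and upper: "(\<Sum>n. (norm (ip h (f n)))\<^sup>2) \<le> B * (norm h)\<^sup>2" if "h \<in> W" for h
    using bspec[OF AB that] by simp_all
  have dec: "\<exists>p\<in>W. norm p \<le> norm h \<and> h - p \<in> orth_compl ip W \<and> (\<forall>n. ip h (f n) = ip p (f n))" for h
  proof -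
    obtain p where p: "p \<in> W" "h - p \<in> orth_compl ip W" using projection_exists[OF W] by blast
    then have "ip (h - p) (f n) = 0" for n using fW by (auto simp: orth_compl_def)
    moreover have "(norm h)\<^sup>2 = (norm (h - p))\<^sup>2 + (norm p)\<^sup>2"
      using pythagoras[of "h - p" p] p by (auto simp: orth_compl_def)
    then have "(norm p)\<^sup>2 \<le> (norm h)\<^sup>2" by simp
    then have "norm p \<le> norm h" by (rule power2_le_imp_le) simp
    ultimately show ?thesis using p by (auto simp: ip_diff_left)
  qed
  have sf: "summable (\<lambda>n. (norm (ip h (f n)))\<^sup>2)" for h
  proof -
    obtain p where p: "p \<in> W" "\<And>n. ip h (f n) = ip p (f n)" using dec[of h] by blast
    show ?thesis unfolding p(2) by (rule summ[OF p(1)])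
  qed
  define T' where "T' = (\<lambda>h. Abs_ell2 (\<lambda>n. ip h (f n)))"
  have cT': "coord (T' h) n = ip h (f n)" for h n
    unfolding T'_def using sf[of h] by (simp add: Abs_ell2_inverse)
  have T': "bounded_op scl ell2_scale T'"
  proof (rule anal.bounded_opI)
    show "T' (x + y) = T' x + T' y" for x y
      by (rule coord_ext) (simp add: cT' coord_add ip_add_left)
    show "T' (scl a x) = ell2_scale a (T' x)" for a x
      by (rule coord_ext) (simp add: cT' coord_scale ip_scale_left)
    show "norm (T' h) \<le> sqrt B * norm h" for h
    proof (rule power2_le_imp_le)
      obtain p where p: "p \<in> W" "norm p \<le> norm h" "\<And>n. ip h (f n) = ip p (f n)"
        using dec[of h] by blast
      have "(norm (T' h))\<^sup>2 \<le> B * (norm p)\<^sup>2"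
        using upper[OF p(1)] by (simp add: norm_ell2_sq cT' p(3))
      also have "\<dots> \<le> B * (norm h)\<^sup>2" using p(2) B by (intro mult_left_mono power_mono) auto
      finally show "(norm (T' h))\<^sup>2 \<le> (sqrt B * norm h)\<^sup>2" using B by (simp add: power_mult_distrib)
    qed (use B in auto)
  qed
  obtain T where T: "bounded_op ell2_scale scl T" and adj0: "\<And>x y. ell2_ip (T' x) y = ip x (T y)"
    using anal.adjoint_exists[OF T'] by blast
  have adj: "ip (T x) y = ell2_ip x (T' y)" for x y by (rule anal.adjoint_sym[of T' T, OF adj0])
  have Te: "T (ell2_basis n) = f n" for n
    by (rule ip_ext_right) (simp add: adj0[symmetric] ell2_ip_basis cT')
  have low: "norm h \<le> (1 / sqrt A) * norm (T' h)" if "h \<in> W" for h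
  proof -
    have "(sqrt A * norm h)\<^sup>2 \<le> (norm (T' h))\<^sup>2"
      using lower[OF that] A by (simp add: norm_ell2_sq cT' power_mult_distrib)
    then have "sqrt A * norm h \<le> norm (T' h)" by (rule power2_le_imp_le) simp
    then show ?thesis using A by (simp add: field_simps)
  qed
  have "closed_subspace ell2_scale (T' ` W)"
    using anal.closed_image_bounded_below[OF T' W _ low] A by simp
  moreover have "T' ` W = range T'"
  proof -
    have "T' h \<in> T' ` W" for h
    proof -
      obtain p where "p \<in> W" "\<And>n. ip h (f n) = ip p (f n)" using dec[of h] by blast
      then have "T' h = T' p" "p \<in> W" by (auto intro: coord_ext simp: cT')
      then show ?thesis by blast
    qed
    then show ?thesis by blast
  qed
  ultimately have "closed_subspace ell2_scale (range T')" by simp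
  from anal.closed_range_adjoint[OF T' T adj0 this] have clT: "closed_subspace scl (range T)" .
  have T'0: "T' y = 0" if "y \<in> orth_compl ip W" for y
    using that fW by (intro coord_ext) (auto simp: cT' zero_ell2.rep_eq orth_compl_def)
  have "range T = W"
  proof
    show "range T \<subseteq> W"
    proof (rule image_subsetI, rule orth_compl_orth_compl[OF W])
      show "ip (T a) y = 0" if "y \<in> orth_compl ip W" for a y by (simp add: adj T'0[OF that])
    qed
    show "W \<subseteq> range T"
    proof (rule subsetI, rule orth_compl_orth_compl[OF clT])
      fix w y assume w: "w \<in> W" and y: "y \<in> orth_compl ip (range T)"
      have T'y: "T' y = 0" using synth.adjoint_zero_iff[of T T', OF adj] y by blast
      obtain p where p: "p \<in> W" "y - p \<in> orth_compl ip W" using dec[of y] by blast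
      have "T' p = 0" using T'0[OF p(2)] T'y by (simp add: bounded_op_diff[OF T'])
      with low[OF p(1)] have "p = 0" by simp
      with p(2) w have "ip y w = 0" by (auto simp: orth_compl_def)
      then show "ip w y = 0" using ip_eq_zero_commute by blast
    qed
  qed
  moreover have "synthesis scl f = T" by (rule synthesis_eq[OF T Te])
  ultimately show thesis using that[of T'] T' T Te adj by metis
qed

end

section \<open>Weighted oblique duals\<close>

text \<open>The data to which the weighted problem reduces: \<open>T'\<close> is the adjoint of \<open>T\<close>, while \<open>S\<close>
  and \<open>E\<close> stand for \<open>D\<^sup>1\<^sup>/\<^sup>2\<close> and \<open>D\<^sup>-\<^sup>1\<^sup>/\<^sup>2\<close>.\<close>

locale weighted_oblique_setting = ell2_hilbert_pair scl ip
  for scl :: "'k::rc_scalar \<Rightarrow> 'v::real_normed_vector \<Rightarrow> 'v" and ip +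
  fixes W M :: "'v set" and T :: "'k ell2 \<Rightarrow> 'v" and T' :: "'v \<Rightarrow> 'k ell2"
    and S E :: "'k ell2 \<Rightarrow> 'k ell2"
  assumes W: "closed_subspace scl W" and M: "closed_subspace scl M"
    and direct: "direct_sum_UNIV W (orth_compl ip M)"
    and T: "bounded_op ell2_scale scl T" and T': "bounded_op scl ell2_scale T'"
    and adj: "\<And>x y. ip (T x) y = ell2_ip x (T' y)" and range_T: "range T = W"
    and S: "bounded_op ell2_scale ell2_scale S" and E: "bounded_op ell2_scale ell2_scale E"
    and S_sa: "\<And>x y. ell2_ip (S x) y = ell2_ip x (S y)"
    and SE: "\<And>x. S (E x) = x" and ES: "\<And>x. E (S x) = x"
begin

sublocale seq: hilbert_pair ell2_scale ell2_ip "ell2_scale :: 'k \<Rightarrow> _" ell2_ip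
  by (intro hilbert_pair.intro hilbert_space_ell2)

lemma oblique_decomposition: "\<exists>w\<in>W. x - w \<in> orth_compl ip M"
  using direct unfolding direct_sum_UNIV_def by (metis add_diff_cancel_left')

lemma W_inter_orth_M: "w \<in> W \<Longrightarrow> w \<in> orth_compl ip M \<Longrightarrow> w = 0"
  using direct unfolding direct_sum_UNIV_def by blast

text \<open>Such an \<open>m\<close> is orthogonal to both summands \<open>W\<close> and \<open>M\<^sup>\<bottom>\<close> of the space.\<close>

lemma M_inter_orth_W:
  assumes "m \<in> M" and "\<And>w. w \<in> W \<Longrightarrow> ip w m = 0"
  shows "m = 0"
proof -
  obtain w where "w \<in> W" "m - w \<in> orth_compl ip M" using oblique_decomposition by blast
  then have "ip (m - w) m = 0" "ip w m = 0" using assms by (auto simp: orth_compl_def)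
  then show ?thesis by (simp add: ip_diff_left ip_self)
qed

text \<open>This is where \<open>W + M\<^sup>\<bottom>\<close> being the whole space is used: it says that \<open>T\<close> followed by
  reduction modulo \<open>M\<^sup>\<bottom>\<close> is onto.\<close>

lemma ET'_bounded_below_on_M: "\<exists>C>0. \<forall>m\<in>M. norm m \<le> C * norm (E (T' m))"
proof -
  have "\<exists>z. \<forall>m\<in>M. ip (x - T z) m = 0" for x
    using oblique_decomposition[of x] unfolding range_T[symmetric] by (auto simp: orth_compl_def)
  from synth.adjoint_bounded_below[OF T' adj this]
  obtain C where C: "C > 0" "\<And>m. m \<in> M \<Longrightarrow> norm m \<le> C * norm (T' m)" by blast
  obtain K where K: "K > 0" "\<And>x. norm (S x) \<le> K * norm x" by (rule bounded_op_pos_bound[OF S]) blast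
  have "norm m \<le> C * K * norm (E (T' m))" if "m \<in> M" for m
  proof -
    have "norm m \<le> C * norm (S (E (T' m)))" using C(2)[OF that] by (simp add: SE)
    also have "\<dots> \<le> C * (K * norm (E (T' m)))" by (rule mult_left_mono[OF K(2)]) (use C(1) in simp)
    finally show ?thesis by (simp add: mult.assoc)
  qed
  then show ?thesis using C(1) K(1) by (intro exI[of _ "C * K"]) auto
qed

text \<open>The operator sending \<open>e\<^sub>n\<close> to the dual vector \<open>g\<^sub>n\<close>, that is, the synthesis operator of
  the dual frame.\<close>

definition dual_op :: "('k ell2 \<Rightarrow> 'v) \<Rightarrow> 'k ell2 \<Rightarrow> 'v" where
  "dual_op B = B \<circ> pseudoinverse ell2_scale ell2_ip ell2_scale ell2_ip (E \<circ> T' \<circ> B) \<circ> E"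

text \<open>The Penrose equations are available because \<open>R(E T' B) = E T' M\<close> is closed, \<open>E T'\<close> being
  bounded below on \<open>M\<close>.\<close>

lemma pseudoinverse_ET'B:
  assumes B: "bounded_op ell2_scale scl B" and rB: "range B = M"
  defines "X \<equiv> pseudoinverse ell2_scale ell2_ip ell2_scale ell2_ip (E \<circ> T' \<circ> B)"
  shows "bounded_op ell2_scale ell2_scale X"
    and "\<And>z. E (T' (B (X (E (T' (B z)))))) = E (T' (B z))"
    and "\<And>u. X (E (T' (B (X u)))) = X u"
    and "\<And>u v. ell2_ip (E (T' (B (X u)))) v = ell2_ip u (E (T' (B (X v))))"
proof -
  have ET': "bounded_op scl ell2_scale (E \<circ> T')" by (rule bounded_op_compose[OF T' E])
  have A: "bounded_op ell2_scale ell2_scale (E \<circ> T' \<circ> B)" by (rule bounded_op_compose[OF B ET'])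
  obtain C where "C > 0" "\<And>m. m \<in> M \<Longrightarrow> norm m \<le> C * norm ((E \<circ> T') m)"
    using ET'_bounded_below_on_M by auto
  then have "closed_subspace ell2_scale ((E \<circ> T') ` M)"
    by (rule anal.closed_image_bounded_below[OF ET' M])
  then have cl: "closed_subspace ell2_scale (range (E \<circ> T' \<circ> B))"
    by (simp add: image_comp flip: rB)
  note P = seq.pseudoinverse_Penrose[OF A cl, folded X_def]
  show "bounded_op ell2_scale ell2_scale X" by (rule P(1))
  show "E (T' (B (X (E (T' (B z)))))) = E (T' (B z))" for z using P(2) by (simp add: fun_eq_iff)
  show "X (E (T' (B (X u)))) = X u" for u using P(3) by (simp add: fun_eq_iff)
  show "ell2_ip (E (T' (B (X u)))) v = ell2_ip u (E (T' (B (X v))))" for u v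
    using P(4) by (simp add: self_adjoint_def)
qed

text \<open>Write \<open>A = E T' B\<close>, \<open>X\<close> for its pseudoinverse and \<open>V = B X E\<close>. As \<open>E T'\<close> is injective on
  \<open>M = R(B)\<close>, the equation \<open>A X A = A\<close> cancels to \<open>B X A = B\<close>, which is \<open>V T' = id\<close> on \<open>M\<close>.
  And \<open>X\<close> kills \<open>R(A)\<^sup>\<bottom>\<close>, which contains \<open>S k\<close> for every \<open>k\<close> in the kernel of \<open>T\<close>,
  because \<open>\<langle>S k, E T' y\<rangle> = \<langle>T k, y\<rangle>\<close>.\<close>

lemma dual_op_properties:
  assumes B: "bounded_op ell2_scale scl B" and rB: "range B = M"
  shows "bounded_op ell2_scale scl (dual_op B)" and "range (dual_op B) \<subseteq> M"
    and "\<And>m. m \<in> M \<Longrightarrow> dual_op B (T' m) = m"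
    and "\<And>k. T k = 0 \<Longrightarrow> dual_op B (S (S k)) = 0"
proof -
  define X where "X = pseudoinverse ell2_scale ell2_ip ell2_scale ell2_ip (E \<circ> T' \<circ> B)"
  note X = pseudoinverse_ET'B[OF B rB, folded X_def]
  have V: "dual_op B a = B (X (E a))" for a by (simp add: dual_op_def X_def)
  show "bounded_op ell2_scale scl (dual_op B)"
    unfolding dual_op_def X_def[symmetric] by (intro bounded_op_compose[OF E] bounded_op_compose[OF X(1)] B)
  show "range (dual_op B) \<subseteq> M" using rB by (auto simp: V)
  show "dual_op B (T' m) = m" if m: "m \<in> M" for m
  proof -
    obtain z where z: "m = B z" using m rB by auto
    obtain C where C: "\<And>m. m \<in> M \<Longrightarrow> norm m \<le> C * norm (E (T' m))"
      using ET'_bounded_below_on_M by auto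
    define d where "d = B (X (E (T' (B z)))) - B z"
    have "d \<in> M" unfolding d_def using rB
      by (metis B bounded_op_diff rangeI)
    moreover have "E (T' d) = 0"
      unfolding d_def bounded_op_diff[OF T'] bounded_op_diff[OF E] by (simp add: X(2))
    ultimately have "d = 0" using C[of d] by simp
    then show ?thesis by (simp add: V z d_def)
  qed
  show "dual_op B (S (S k)) = 0" if k: "T k = 0" for k
  proof -
    have "ell2_ip (S k) (E (T' y)) = 0" for y
    proof -
      have "ell2_ip (S k) (E (T' y)) = ell2_ip k (T' y)" by (simp add: S_sa SE)
      also have "\<dots> = ip (T k) y" by (simp add: adj)
      finally show ?thesis by (simp add: k)
    qed
    then have "E (T' (B (X (S k)))) = 0" by (intro synth.H1.ip_all_zero) (simp add: X(4))
    then have "X (S k) = X 0" using X(3)[of "S k"] by simp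
    then show ?thesis by (simp add: V ES bounded_op_zero[OF X(1)] bounded_op_zero[OF B])
  qed
qed

lemma coefficients_of_sums:
  assumes "\<And>n. T (ell2_basis n) = f n"
  shows "(\<lambda>n. scl (coord c n) (f n)) sums h \<longleftrightarrow> T c = h"
  using bounded_op_basis_sums[OF T, of c] assms sums_unique2 by auto

text \<open>The normal equation: a solution \<open>a\<close> of \<open>T a = h\<close> with \<open>D a \<bottom> ker T\<close> has the least
  weighted norm among all solutions, and the excess of another solution is the weighted
  distance to it, so the minimizer is unique.\<close>

lemma orthogonal_solution_norm:
  assumes D: "\<And>x. D x = S (S x)" and perp: "\<And>k. T k = 0 \<Longrightarrow> ell2_ip (S (S a)) k = 0"
    and "T a = T c"
  shows "(weighted_norm D c)\<^sup>2 = (weighted_norm D a)\<^sup>2 + (norm (S (c - a)))\<^sup>2"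
proof -
  have wn: "weighted_norm D x = norm (S x)" for x
    unfolding weighted_norm_def weighted_ip_def D S_sa synth.H1.ip_self rpart_of_real by simp
  have "T (c - a) = 0" using assms(3) by (simp add: bounded_op_diff[OF T])
  then have "ell2_ip (S a) (S (c - a)) = 0" using perp by (simp add: S_sa)
  from synth.H1.pythagoras[OF this] show ?thesis
    by (simp add: wn flip: bounded_op_add[OF S])
qed

text \<open>The coefficients are \<open>a = V' h\<close>, with \<open>V'\<close> the adjoint of \<open>V\<close>. Dualizing \<open>V T' = id\<close>
  on \<open>M\<close> gives \<open>T V' h - h \<in> M\<^sup>\<bottom>\<close>, and for \<open>h \<in> W\<close> this vector lies in \<open>W\<close> too, so it
  vanishes: the reconstruction formula. Dualizing \<open>V D k = 0\<close> for \<open>T k = 0\<close> gives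
  \<open>D V' h \<bottom> ker T\<close>: minimality. The lower frame bound comes from
  \<open>\<parallel>m\<parallel>\<^sup>2 = \<langle>V T' m, m\<rangle> = \<langle>T' m, V' m\<rangle>\<close>.\<close>

lemma dual_op_is_minimal_oblique_dual:
  assumes B: "bounded_op ell2_scale scl B" and rB: "range B = M"
    and f: "\<And>n. T (ell2_basis n) = f n" and D: "\<And>x. D x = S (S x)"
  defines "g \<equiv> \<lambda>n. dual_op B (ell2_basis n)"
  shows "oblique_dual_frame scl ip f W M g"
    and "\<And>h. h \<in> W \<Longrightarrow> \<exists>a. (\<forall>n. coord a n = ip h (g n)) \<and> T a = h \<and>
      (\<forall>k. T k = 0 \<longrightarrow> ell2_ip (S (S a)) k = 0)"
    and "minimal_coefficients scl ip D f W g"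
proof -
  note V = dual_op_properties[OF B rB]
  obtain V' where V': "bounded_op scl ell2_scale V'"
    and adjV: "\<And>x y. ip (dual_op B x) y = ell2_ip x (V' y)"
    using synth.adjoint_exists[OF V(1)] by blast
  have cV': "coord (V' h) n = ip h (g n)" for h n
    unfolding g_def by (rule coord_adjoint[of "dual_op B" V', OF adjV])
  have TV': "T (V' h) = h" if h: "h \<in> W" for h
  proof -
    have "ip (T (V' h) - h) m = 0" if "m \<in> M" for m
    proof -
      have "ip (T (V' h)) m = ell2_ip (V' h) (T' m)" by (rule adj)
      also have "\<dots> = ip h (dual_op B (T' m))" by (rule synth.adjoint_sym[of "dual_op B" V', OF adjV])
      finally show ?thesis using V(3)[OF that] by (simp add: ip_diff_left)
    qed
    moreover have "T (V' h) - h \<in> W"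
      using W h range_T by (auto simp: closed_subspace_def intro!: subspace_diff)
    ultimately have "T (V' h) - h = 0" by (intro W_inter_orth_M) (auto simp: orth_compl_def)
    then show ?thesis by simp
  qed
  have perp: "ell2_ip (S (S (V' h))) k = 0" if "T k = 0" for h k
  proof -
    have "ell2_ip (S (S (V' h))) k = ell2_ip (V' h) (S (S k))" by (simp add: S_sa)
    also have "\<dots> = ip h (dual_op B (S (S k)))"
      by (rule synth.adjoint_sym[of "dual_op B" V', OF adjV])
    finally show ?thesis using V(4)[OF that] by simp
  qed
  show sol: "\<exists>a. (\<forall>n. coord a n = ip h (g n)) \<and> T a = h \<and>
      (\<forall>k. T k = 0 \<longrightarrow> ell2_ip (S (S a)) k = 0)" if "h \<in> W" for h
    using cV' TV'[OF that] perp by blast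
  obtain K where K: "K > 0" "\<And>x. norm (V' x) \<le> K * norm x" by (rule bounded_op_pos_bound[OF V']) blast
  obtain L where L: "L > 0" "\<And>x. norm (T' x) \<le> L * norm x" by (rule bounded_op_pos_bound[OF T']) blast
  have sq: "(norm (V' m))\<^sup>2 = (\<Sum>n. (norm (ip m (g n)))\<^sup>2)" for m
    by (simp add: norm_ell2_sq cV')
  have summ: "summable (\<lambda>n. (norm (ip m (g n)))\<^sup>2)" for m
    using summable_coord[of "V' m"] by (simp add: cV')
  have upper: "(norm (V' m))\<^sup>2 \<le> K\<^sup>2 * (norm m)\<^sup>2" for m
    unfolding power_mult_distrib[symmetric] by (intro power_mono K) simp
  have lower: "(1 / L)\<^sup>2 * (norm m)\<^sup>2 \<le> (norm (V' m))\<^sup>2" if m: "m \<in> M" for m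
  proof -
    have "(norm m)\<^sup>2 = norm (ip (dual_op B (T' m)) m)"
      by (simp add: V(3)[OF m] ip_self norm_power)
    also have "\<dots> = norm (ell2_ip (T' m) (V' m))" by (simp add: adjV)
    also have "\<dots> \<le> L * norm m * norm (V' m)"
      by (rule order_trans[OF synth.H1.Cauchy_Schwarz mult_right_mono[OF L(2)]]) simp
    finally have "norm m * norm m \<le> (L * norm (V' m)) * norm m"
      by (simp add: power2_eq_square mult_ac)
    then have "norm m \<le> L * norm (V' m)" using L(1) by (cases "m = 0") auto
    then have "1 / L * norm m \<le> norm (V' m)" using L(1) by (simp add: field_simps)
    then show ?thesis
      unfolding power_mult_distrib[symmetric] by (intro power_mono) (use L(1) in auto)
  qed
  have "frame_for ip g M"
    unfolding frame_for_def sq[symmetric]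
  proof (intro conjI exI ballI)
    show "range g \<subseteq> M" using V(2) by (auto simp: g_def)
    show "0 < (1 / L)\<^sup>2" "0 < K\<^sup>2" using K(1) L(1) by auto
  qed (use summ lower upper in auto)
  moreover have "(\<lambda>n. scl (ip h (g n)) (f n)) sums h" if "h \<in> W" for h
    using coefficients_of_sums[OF f, of "V' h" h] TV'[OF that] by (simp add: cV')
  ultimately show "oblique_dual_frame scl ip f W M g"
    by (simp add: oblique_dual_frame_def)
  show "minimal_coefficients scl ip D f W g"
    unfolding minimal_coefficients_def coefficients_of_sums[OF f]
  proof (intro ballI)
    fix h assume "h \<in> W"
    then obtain a where a: "\<And>n. coord a n = ip h (g n)" "T a = h"
      "\<And>k. T k = 0 \<Longrightarrow> ell2_ip (S (S a)) k = 0"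
      using sol by blast
    have "weighted_norm D a \<le> weighted_norm D c" if "T c = h" for c
    proof (rule power2_le_imp_le)
      show "(weighted_norm D a)\<^sup>2 \<le> (weighted_norm D c)\<^sup>2"
        using orthogonal_solution_norm[OF D a(3), of c] a(2) that by simp
      show "0 \<le> weighted_norm D c"
        unfolding weighted_norm_def weighted_ip_def D S_sa synth.H1.ip_self rpart_of_real by simp
    qed
    with a(1) show "\<exists>a. (\<forall>n. coord a n = ip h (g n)) \<and>
        (\<forall>c. T c = h \<longrightarrow> weighted_norm D a \<le> weighted_norm D c)" by blast
  qed
qed

text \<open>Minimizers being unique, the coefficients \<open>\<langle>h, g\<^sub>n\<rangle>\<close> of a competing dual are
  the same for every \<open>h \<in> W\<close>. They determine \<open>g\<^sub>n \<in> M\<close> since \<open>M \<inter> W\<^sup>\<bottom> = {0}\<close>.\<close>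

lemma minimal_oblique_dual_unique:
  assumes B: "bounded_op ell2_scale scl B" and rB: "range B = M"
    and f: "\<And>n. T (ell2_basis n) = f n" and D: "\<And>x. D x = S (S x)"
    and dual: "oblique_dual_frame scl ip f W M g" and min: "minimal_coefficients scl ip D f W g"
  shows "g = (\<lambda>n. dual_op B (ell2_basis n))"
proof
  fix n
  let ?g = "\<lambda>n. dual_op B (ell2_basis n)"
  have gM: "g n \<in> M" using dual by (auto simp: oblique_dual_frame_def frame_for_def)
  have g'M: "?g n \<in> M" using dual_op_properties(2)[OF B rB] by blast
  have "ip h (g n - ?g n) = 0" if h: "h \<in> W" for h
  proof -
    obtain a where a: "\<And>n. coord a n = ip h (?g n)" "T a = h"
      "\<And>k. T k = 0 \<Longrightarrow> ell2_ip (S (S a)) k = 0"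
      using dual_op_is_minimal_oblique_dual(2)[OF B rB f D h] by blast
    obtain c where c: "\<And>n. coord c n = ip h (g n)"
      "\<And>b. T b = h \<Longrightarrow> weighted_norm D c \<le> weighted_norm D b"
      using min h unfolding minimal_coefficients_def coefficients_of_sums[OF f] by blast
    have Tc: "T c = h"
      using dual h coefficients_of_sums[OF f, of c h] by (simp add: oblique_dual_frame_def c(1))
    have "(weighted_norm D c)\<^sup>2 \<le> (weighted_norm D a)\<^sup>2"
      by (intro power_mono c(2) a(2))
        (simp add: weighted_norm_def weighted_ip_def D S_sa synth.H1.ip_self del: of_real_power)
    then have "(norm (S (c - a)))\<^sup>2 \<le> 0"
      using orthogonal_solution_norm[OF D a(3), of c] a(2) Tc by simp
    then have "S (c - a) = 0" by simp
    then have "c = a" by (metis ES bounded_op_zero[OF E] eq_iff_diff_eq_0)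
    then show ?thesis using a(1)[of n] c(1)[of n] by (simp add: ip_diff_right)
  qed
  moreover have "g n - ?g n \<in> M"
    using M gM g'M by (simp add: closed_subspace_def subspace_diff)
  ultimately show "g n = ?g n" using M_inter_orth_W by fastforce
qed

text \<open>The orthogonal projection \<open>P\<close> onto \<open>M\<close> maps \<open>W\<close> onto \<open>M\<close>: if \<open>m = w + y\<close> with \<open>w \<in> W\<close>
  and \<open>y \<in> M\<^sup>\<bottom>\<close>, then \<open>P w = m\<close>. So \<open>P T\<close> is a bounded operator onto \<open>M\<close>.\<close>

lemma exists_bounded_op_onto_M: "\<exists>B. bounded_op ell2_scale scl B \<and> range B = M"
proof -
  define P where "P = (\<lambda>x. SOME p. p \<in> M \<and> x - p \<in> orth_compl ip M)"
  have P: "P x \<in> M \<and> x - P x \<in> orth_compl ip M" for x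
    unfolding P_def by (rule someI_ex) (use projection_exists[OF M] in blast)
  have subM: "subspace M" using M by (simp add: closed_subspace_def)
  have uniq: "P x = p" if "p \<in> M" "x - p \<in> orth_compl ip M" for x p
  proof -
    have "P x - p \<in> M" using P[of x] that by (intro subspace_diff[OF subM]) auto
    moreover have "(x - p) - (x - P x) \<in> orth_compl ip M"
      using subspace_diff[OF subspace_orth_compl, of "x - p" M "x - P x"] P[of x] that by blast
    ultimately have "ip (P x - p) (P x - p) = 0" by (auto simp: orth_compl_def)
    then show ?thesis by (simp add: ip_self)
  qed
  interpret HH: hilbert_pair scl ip scl ip
    by (intro hilbert_pair.intro hilbert_space_axioms)
  have Pb: "bounded_op scl scl P"
  proof (rule HH.bounded_opI[where K = 1])
    show "P (x + y) = P x + P y" for x y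
      using P[of x] P[of y] subspace_add[OF subspace_orth_compl[of M], of "x - P x" "y - P y"]
      by (intro uniq subspace_add[OF subM]) (auto simp: algebra_simps)
    show "P (scl a x) = scl a (P x)" for a x
      using P[of x] subspace_scale[OF subspace_orth_compl[of M], of "x - P x" a]
      by (intro uniq subspace_scale[OF subM]) (auto simp: scale_right_diff_distrib)
    show "norm (P x) \<le> 1 * norm x" for x
    proof -
      have "(norm x)\<^sup>2 = (norm (x - P x))\<^sup>2 + (norm (P x))\<^sup>2"
        using pythagoras[of "x - P x" "P x"] P[of x] by (simp add: orth_compl_def)
      then have "(norm (P x))\<^sup>2 \<le> (norm x)\<^sup>2" by simp
      then have "norm (P x) \<le> norm x" by (rule power2_le_imp_le) simp
      then show ?thesis by simp
    qed
  qed
  have "M \<subseteq> range (P \<circ> T)"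
  proof
    fix m assume m: "m \<in> M"
    obtain w where w: "w \<in> W" "m - w \<in> orth_compl ip M" using oblique_decomposition by blast
    have "- (m - w) \<in> orth_compl ip M" by (intro subspace_neg subspace_orth_compl w(2))
    then have "P w = m" by (intro uniq m) simp
    then show "m \<in> range (P \<circ> T)" using w(1) unfolding range_T[symmetric] by auto
  qed
  then have "range (P \<circ> T) = M" using P by (auto simp del: mem_Collect_eq)
  then show ?thesis using bounded_op_compose[OF T Pb] by blast
qed

end

theorem proposition4p4:
  fixes scl :: "'k::rc_scalar \<Rightarrow> 'v::real_normed_vector \<Rightarrow> 'v"
    and ip :: "'v \<Rightarrow> 'v \<Rightarrow> 'k"
    and f :: "nat \<Rightarrow> 'v"
    and W M :: "'v set"
    and T :: "'k ell2 \<Rightarrow> 'v"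
    and D :: "'k ell2 \<Rightarrow> 'k ell2"
  assumes "hilbert_space scl ip"
    and "separable_space (euclidean :: 'v topology)"
    and "closed_subspace scl W"
    and "frame_for ip f W"
    and "T = synthesis scl f"
    and "closed_subspace scl M"
    and "direct_sum_UNIV W (orth_compl ip M)"
    and "D \<in> diag_ops"
  shows "{g. oblique_dual_frame scl ip f W M g \<and> minimal_coefficients scl ip D f W g} =
    {g. \<exists>B. bounded_op ell2_scale scl B \<and> range B = M \<and>
       g = (\<lambda>n. B (pseudoinverse ell2_scale ell2_ip ell2_scale ell2_ip
                     (op_inv_sqrt ell2_scale ell2_ip D \<circ> op_adjoint ell2_ip ip T \<circ> B)
                     (op_inv_sqrt ell2_scale ell2_ip D (ell2_basis n))))}"
proof -
  interpret ell2_hilbert_pair scl ip by (intro ell2_hilbert_pair.intro assms(1))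
  obtain T' where T': "bounded_op scl ell2_scale T'" and T: "bounded_op ell2_scale scl T"
    and f: "\<And>n. T (ell2_basis n) = f n"
    and adj: "\<And>x y. ip (T x) y = ell2_ip x (T' y)" and rT: "range T = W"
    by (rule frame_synthesis[OF assms(3,4), folded assms(5)]) (rule that; assumption)
  define E where "E = op_inv_sqrt ell2_scale ell2_ip D"
  obtain S where S: "bounded_op ell2_scale ell2_scale S" "bounded_op ell2_scale ell2_scale E"
    "\<And>x y. ell2_ip (S x) y = ell2_ip x (S y)"
    "\<And>x. S (E x) = x" "\<And>x. E (S x) = x" and D: "\<And>x. D x = S (S x)"
    by (rule diag_ops_sqrt[OF assms(8), folded E_def]) (rule that; assumption)
  interpret weighted_oblique_setting scl ip W M T T' S E
    by unfold_locales (fact assms T T' adj rT S)+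
  have T'_eq: "op_adjoint ell2_ip ip T = T'" by (rule synth.op_adjoint_eq[OF adj])
  have rhs: "(\<lambda>n. B (pseudoinverse ell2_scale ell2_ip ell2_scale ell2_ip
        (op_inv_sqrt ell2_scale ell2_ip D \<circ> op_adjoint ell2_ip ip T \<circ> B)
        (op_inv_sqrt ell2_scale ell2_ip D (ell2_basis n)))) = (\<lambda>n. dual_op B (ell2_basis n))" for B
    by (simp add: dual_op_def T'_eq flip: E_def)
  show ?thesis
    unfolding rhs
  proof (intro Collect_cong iffI)
    fix g assume g: "oblique_dual_frame scl ip f W M g \<and> minimal_coefficients scl ip D f W g"
    obtain B where B: "bounded_op ell2_scale scl B" "range B = M"
      using exists_bounded_op_onto_M by blast
    have "g = (\<lambda>n. dual_op B (ell2_basis n))"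
      by (rule minimal_oblique_dual_unique[OF B f D conjunct1[OF g] conjunct2[OF g]])
    then show "\<exists>B. bounded_op ell2_scale scl B \<and> range B = M \<and>
        g = (\<lambda>n. dual_op B (ell2_basis n))"
      using B by blast
  next
    fix g assume "\<exists>B. bounded_op ell2_scale scl B \<and> range B = M \<and>
        g = (\<lambda>n. dual_op B (ell2_basis n))"
    then obtain B where B: "bounded_op ell2_scale scl B" "range B = M"
      and g: "g = (\<lambda>n. dual_op B (ell2_basis n))" by (elim exE conjE)
    show "oblique_dual_frame scl ip f W M g \<and> minimal_coefficients scl ip D f W g"
      unfolding g
      by (rule conjI[OF dual_op_is_minimal_oblique_dual(1)[OF B f D]
            dual_op_is_minimal_oblique_dual(3)[OF B f D]])
  qed
qed

end
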